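(* Let $n>1$ be an odd integer, let $r\geqslant 1$, and let $d\in\{1,2\}$. Then, modulo \[ [n^r]\prod_{j=0}^{(n^{r-1}-1)/d}(1-aq^{(2j+1)n})(a-q^{(2j+1)n}), \] we have \[ \sum_{k=0}^{(n^r-1)/d} q^{k^2}[6k+1]\frac{(aq;q^2)_k (q/a;q^2)_k (q^2;q^4)_k }{(aq^4;q^4)_k(q^4/a;q^4)_k(q^4;q^4)_k} \equiv (-q)^{(1-n)/2} [n] \sum_{k=0}^{(n^{r-1}-1)/d} q^{nk^2}[6k+1]_{q^n}\frac{(aq^n;q^{2n})_k (q^n/a;q^{2n})_k (q^{2n};q^{4n})_k }{(aq^{4n};q^{4n})_k(q^{4n}/a;q^{4n})_k(q^{4n};q^{4n})_k}. \]
   Context: Here $a$ is an indeterminate and both sides are rational functions in $q$ and $a$. Notation: $(x;q)_k=(1-x)(1-xq)\cdots(1-xq^{k-1})$ (with $(x;q)_0=1$) is the $q$-shifted factorial; $[m]=[m]_q=1+q+\cdots+q^{m-1}$ is the $q$-integer, and $[m]_{q^n}=1+q^n+\cdots+q^{n(m-1)}$. For rational functions $A,B$ in $q,a$ and a polynomial $P$ in $q,a$, $A\equiv B\pmod{P}$ means that $A-B$ can be written as a quotient of polynomials whose numerator is divisible by $P$ and whose denominator is relatively prime to $P$. *)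

theory Defs
  imports "HOL-Computational_Algebra.Polynomial" "HOL-Computational_Algebra.Fraction_Field"
begin

text \<open>Polynomials in the two indeterminates a and q with integer coefficients are
  modelled as int poly poly: the inner variable is q, the outer variable is a.
  Rational functions in q, a are elements of the fraction field.\<close>

type_synonym ratfun = "int poly poly fract"

definition qvar :: "int poly poly" where "qvar = [:[:0, 1:]:]"
definition avar :: "int poly poly" where "avar = [:0, 1:]"

definition emb :: "int poly poly \<Rightarrow> ratfun" where "emb p = Fract p 1"

definition qpoch :: "'a::comm_ring_1 \<Rightarrow> 'a \<Rightarrow> nat \<Rightarrow> 'a" where
  "qpoch x p k = (\<Prod>i<k. 1 - x * p ^ i)"

definition qint :: "'a::comm_ring_1 \<Rightarrow> nat \<Rightarrow> 'a" where
  "qint p m = (\<Sum>i<m. p ^ i)"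

definition qcong :: "ratfun \<Rightarrow> ratfun \<Rightarrow> int poly poly \<Rightarrow> bool" where
  "qcong A B P \<longleftrightarrow> (\<exists>N D. D \<noteq> 0 \<and> A - B = Fract N D \<and> P dvd N \<and> coprime D P)"

end

theory Submission
  imports Defs Complex_Main "HOL-Computational_Algebra.Polynomial_Factorial"
begin

text \<open>At \<open>a = q^M\<close> or \<open>a = q^(-M)\<close> with \<open>M\<close> odd, the sum terminates and equals \<open>(-q)^((1-M)/2) [M]\<close>,
  which follows from the initial cases \<open>M = 1, 3\<close> by a telescoping recurrence \<open>M \<mapsto> M + 4\<close>. Applied with
  \<open>M = (2j+1)n\<close> on the left and with \<open>M = 2j+1\<close> and base \<open>q^n\<close> on the right, it gives the congruence modulo
  the linear factors in \<open>a\<close>.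

  Modulo \<open>[n^r]\<close> both sides vanish. At a primitive root of unity \<open>q\<close> of odd order \<open>e > 1\<close> the summand is
  multiplicative along blocks of length \<open>e\<close>, and is zero on the second half of each block. The sum over
  the first half, cleared of denominators, is a polynomial in \<open>a\<close> of degree at most \<open>e - 1\<close>; the
  terminating evaluation for \<open>M = 1, 3, ..., e\<close> shows that all \<open>e\<close>-th roots of unity are roots of it.
  As \<open>[n^r]\<close> is monic with simple complex roots, divisibility by it can be tested at roots of unity.\<close>

subsection \<open>Gaussian binomial coefficients and the summand\<close>

text \<open>Defined by the q-Pascal rule instead of a quotient of q-factorials, so that it exists in
  every commutative ring and keeps its value at roots of unity, where that quotient can become
  \<open>0/0\<close>.\<close>

fun gbin :: "'a::comm_ring_1 \<Rightarrow> nat \<Rightarrow> nat \<Rightarrow> 'a" where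
  "gbin x n 0 = 1"
| "gbin x 0 (Suc k) = 0"
| "gbin x (Suc n) (Suc k) = gbin x n k + x ^ Suc k * gbin x n (Suc k)"

text \<open>Pascal's rule and the induction hypothesis give two relations, \<open>B\<close> raising
  both indices and \<open>R\<close> raising only the upper one; both express the same multiple of
  \<open>gbin x n k\<close>, which yields the claim for \<open>Suc n\<close>.\<close>

lemma gbin_step_k: "k \<le> n \<Longrightarrow> (1 - x ^ Suc k) * gbin x n (Suc k) = (1 - x ^ (n - k)) * gbin x n k"
proof (induction n arbitrary: k)
  case 0
  then show ?case by simp
next
  case (Suc n)
  have B: "(1 - x ^ Suc k) * gbin x (Suc n) (Suc k) = (1 - x ^ Suc n) * gbin x n k" if "k \<le> n" for k
  proof -
    have e: "x ^ Suc k * x ^ (n - k) = x ^ Suc n"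
      using that by (simp del: power_Suc flip: power_add)
    have "(1 - x ^ Suc k) * gbin x (Suc n) (Suc k)
        = (1 - x ^ Suc k) * gbin x n k + x ^ Suc k * ((1 - x ^ Suc k) * gbin x n (Suc k))"
      by (simp add: algebra_simps)
    also have "\<dots> = (1 - x ^ Suc k) * gbin x n k + x ^ Suc k * ((1 - x ^ (n - k)) * gbin x n k)"
      using Suc.IH[OF that] by simp
    also have "\<dots> = (1 - x ^ Suc k * x ^ (n - k)) * gbin x n k"
      by (simp add: algebra_simps)
    finally show ?thesis by (simp only: e)
  qed
  show ?case
  proof (cases k)
    case 0
    then show ?thesis using B[of 0] by simp
  next
    case [simp]: (Suc m)
    have mn: "m \<le> n" using Suc.prems by simp
    have R: "(1 - x ^ (n - m)) * gbin x (Suc n) (Suc m) = (1 - x ^ Suc n) * gbin x n (Suc m)"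
    proof -
      have e: "x ^ Suc m * x ^ (n - m) = x ^ Suc n"
        using mn by (simp del: power_Suc flip: power_add)
      have "(1 - x ^ (n - m)) * gbin x (Suc n) (Suc m)
          = (1 - x ^ (n - m)) * gbin x n m + x ^ Suc m * (1 - x ^ (n - m)) * gbin x n (Suc m)"
        by (simp add: algebra_simps)
      also have "\<dots> = (1 - x ^ Suc m) * gbin x n (Suc m) + x ^ Suc m * (1 - x ^ (n - m)) * gbin x n (Suc m)"
        using Suc.IH[OF mn] by simp
      also have "\<dots> = (1 - x ^ Suc m * x ^ (n - m)) * gbin x n (Suc m)"
        by (simp add: algebra_simps)
      finally show ?thesis by (simp only: e)
    qed
    show ?thesis
    proof (cases "Suc m \<le> n")
      case True
      then show ?thesis using B[of "Suc m"] R by simp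
    next
      case False
      then have "n = m" using mn by simp
      have z: "gbin x i j = 0" if "i < j" for i j :: nat
        using that
      proof (induction i arbitrary: j)
        case 0 then show ?case by (cases j) auto
      next
        case (Suc i) then show ?case by (cases j) auto
      qed
      show ?thesis using \<open>n = m\<close> by (simp add: z)
    qed
  qed
qed

text \<open>Pascal's rule with the neighbouring coefficient eliminated by
  \<open>gbin_step_k\<close>; nothing is cancelled, so it also holds when
  \<open>x ^ Suc k = 1\<close>.\<close>

lemma gbin_step_both:
  assumes "k \<le> n"
  shows "(1 - x ^ Suc k) * gbin x (Suc n) (Suc k) = (1 - x ^ Suc n) * gbin x n k"
proof -
  have e: "x ^ Suc k * x ^ (n - k) = x ^ Suc n"
    using assms by (simp del: power_Suc flip: power_add)
  have "(1 - x ^ Suc k) * gbin x (Suc n) (Suc k)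
      = (1 - x ^ Suc k) * gbin x n k + x ^ Suc k * ((1 - x ^ Suc k) * gbin x n (Suc k))"
    by (simp add: algebra_simps)
  also have "\<dots> = (1 - x ^ Suc k) * gbin x n k + x ^ Suc k * ((1 - x ^ (n - k)) * gbin x n k)"
    using gbin_step_k[OF assms, of x] by simp
  also have "\<dots> = (1 - x ^ Suc k * x ^ (n - k)) * gbin x n k"
    by (simp add: algebra_simps)
  finally show ?thesis by (simp only: e)
qed

text \<open>Multiplied by \<open>1 - x ^ Suc k\<close> rather than its square, so that it still determines the
  next central coefficient at a root of unity.\<close>

lemma gbin_central_Suc:
  "(1 - x ^ Suc k) * gbin x (2 * Suc k) (Suc k)
    = (1 + x ^ Suc k) * (1 - x ^ Suc (2 * k)) * gbin x (2 * k) k"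
proof -
  have "(1 - x ^ Suc k) * gbin x (2 * Suc k) (Suc k)
      = (1 - x ^ Suc k) * gbin x (Suc (2 * k)) k
        + x ^ Suc k * ((1 - x ^ Suc k) * gbin x (Suc (2 * k)) (Suc k))"
    by (simp add: algebra_simps)
  also have "(1 - x ^ Suc k) * gbin x (Suc (2 * k)) k = (1 - x ^ Suc k) * gbin x (Suc (2 * k)) (Suc k)"
    using gbin_step_k[of k "Suc (2 * k)" x] by (simp add: Suc_diff_le mult_2)
  also have "(1 - x ^ Suc k) * gbin x (Suc (2 * k)) (Suc k) = (1 - x ^ Suc (2 * k)) * gbin x (2 * k) k"
    by (rule gbin_step_both) simp
  finally show ?thesis by (simp add: algebra_simps)
qed

text \<open>In the summand, \<open>(q^2;q^4)_k / (q^4;q^4)_k\<close> is replaced by the central Gaussian binomial in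
  base \<open>q^2\<close> over the squares of \<open>1 + q^(2j)\<close>, whose denominators do not vanish at roots of unity
  of odd order; the powers of \<open>a\<close> cancel.\<close>

definition den_factor :: "'a::comm_ring_1 \<Rightarrow> 'a \<Rightarrow> nat \<Rightarrow> 'a" where
  "den_factor q a j = (1 - a * q ^ (4 * j + 4)) * (a - q ^ (4 * j + 4)) * (1 + q ^ (2 * j + 2)) ^ 2"

definition num_factor :: "'a::comm_ring_1 \<Rightarrow> 'a \<Rightarrow> nat \<Rightarrow> 'a" where
  "num_factor q a j = (1 - a * q ^ (2 * j + 1)) * (a - q ^ (2 * j + 1))"

definition term_den :: "'a::comm_ring_1 \<Rightarrow> 'a \<Rightarrow> nat \<Rightarrow> 'a" where
  "term_den q a k = (\<Prod>j<k. den_factor q a j)"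

definition term_num :: "'a::comm_ring_1 \<Rightarrow> 'a \<Rightarrow> nat \<Rightarrow> 'a" where
  "term_num q a k = q ^ (k ^ 2) * qint q (6 * k + 1) * gbin (q ^ 2) (2 * k) k * (\<Prod>j<k. num_factor q a j)"

text \<open>The numerator of the whole sum over the common denominator
  \<open>term_den q a K\<close>. Being free of division, it can be read in polynomial rings and at
  points where the denominator vanishes.\<close>

definition sum_num :: "'a::comm_ring_1 \<Rightarrow> 'a \<Rightarrow> nat \<Rightarrow> 'a" where
  "sum_num q a K = (\<Sum>k=0..K. term_num q a k * (\<Prod>j=k..<K. den_factor q a j))"

lemma qint_mult: "(1 - p) * qint p m = 1 - p ^ m"
  by (simp add: qint_def one_diff_power_eq)

lemma sum_num_div:
  fixes q a :: "'a::field"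
  assumes "term_den q a K \<noteq> 0"
  shows "(\<Sum>k=0..K. term_num q a k / term_den q a k) = sum_num q a K / term_den q a K"
proof -
  have "term_num q a k / term_den q a k = term_num q a k * (\<Prod>j=k..<K. den_factor q a j) / term_den q a K"
    if "k \<in> {0..K}" for k
  proof -
    have "term_den q a K = term_den q a k * (\<Prod>j=k..<K. den_factor q a j)"
      unfolding term_den_def lessThan_atLeast0
      using that by (intro prod.atLeastLessThan_concat[symmetric]) auto
    then show ?thesis using assms by auto
  qed
  then show ?thesis unfolding sum_num_def sum_divide_distrib by (intro sum.cong) auto
qed

section \<open>The telescoping recurrence under the shift
  \<open>a \<mapsto> a * q ^ 4\<close>\<close>

lemma telescoping_identity:
  fixes q a y :: "'a::comm_ring_1"
  shows "- (q^2)*(1-q*y^3)*(1-a*q*y)*(1-a*q^3*y)*(a-y^2) - (1-q*y^3)*(a*q^3-y)*(a*q-y)*(1-a*q^4*y^2)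
   = (1+a*q^2)*(y*(1-q*y)*(1-q^2*y^2)*(1-a*q*y)*(a*q^3-y) - q*(1-y^2)*(a-y^2)*(q-y)*(1-a*q^4*y^2))"
  by (simp add: algebra_simps power_numeral_reduce)

definition qterm :: "'a::field \<Rightarrow> 'a \<Rightarrow> nat \<Rightarrow> 'a" where
  "qterm q a k = term_num q a k / term_den q a k"

text \<open>Replacing \<open>a\<close> by \<open>a * q ^ 4\<close> moves the products with step
  \<open>q ^ 2\<close> by two places and, as in \<open>prod_shift1\<close>, those with step
  \<open>q ^ 4\<close> by one. Multiplying the removed factors back avoids division.\<close>

lemma prod_shift2:
  fixes f :: "nat \<Rightarrow> 'a::comm_ring_1"
  shows "(\<Prod>j<k. f (j + 2)) * (f 0 * f 1) = (\<Prod>j<k. f j) * (f k * f (Suc k))"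
proof (induction k)
  case (Suc k)
  have "(\<Prod>j<Suc k. f (j + 2)) * (f 0 * f 1) = ((\<Prod>j<k. f (j + 2)) * (f 0 * f 1)) * f (k + 2)"
    by (simp add: mult_ac)
  also have "\<dots> = (\<Prod>j<Suc k. f j) * (f (Suc k) * f (Suc (Suc k)))"
    unfolding Suc by (simp add: mult_ac)
  finally show ?case .
qed simp

lemma prod_shift1:
  fixes f :: "nat \<Rightarrow> 'a::comm_ring_1"
  shows "(\<Prod>j<k. f (Suc j)) * f 0 = (\<Prod>j<k. f j) * f k"
  using prod.lessThan_Suc_shift[of f k] prod.lessThan_Suc[of f k] by (simp add: mult_ac)

text \<open>A q-Zeilberger recurrence for \<open>a \<mapsto> a q^4\<close>: the certificate \<open>g\<close> below was found by solving a
  linear system for its numerator. The shift has to be by \<open>q^4\<close>, since \<open>q^2\<close> moves the residue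
  class of the exponents in the base \<open>q^4\<close> products.\<close>

lemma qterm_telescope:
  fixes q a :: "'a::field"
  assumes q0: "q \<noteq> 0" and D0: "\<And>j. a - q ^ (4 * j) \<noteq> 0" and C0: "\<And>j. 1 - a * q ^ Suc j \<noteq> 0"
    and E0: "\<And>j. 1 + q ^ Suc j \<noteq> 0" and Q0: "\<And>j. 1 - q ^ Suc j \<noteq> 0"
  shows "\<exists>X. q ^ 2 * (1 - a) * (\<Sum>k<K. qterm q (a * q ^ 4) k) - (1 - a * q ^ 4) * (\<Sum>k<K. qterm q a k)
           = (\<Prod>j<K. a * q ^ 4 - q ^ (2 * j + 1)) * X"
proof -
  define A where "A k = (\<Prod>j<k. 1 - a * q ^ (2 * j + 1))" for k
  define B where "B k = (\<Prod>j<k. a * q ^ 4 - q ^ (2 * j + 1))" for k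
  define C where "C k = (\<Prod>j<k. 1 - a * q ^ (4 * j + 4))" for k
  define D where "D k = (\<Prod>j<k. a - q ^ (4 * j + 4))" for k
  define b where "b k = gbin (q ^ 2) (2 * k) k / (\<Prod>j<k. (1 + q ^ (2 * j + 2)) ^ 2)" for k
  define y where "y k = q ^ (2 * k)" for k
  \<comment> \<open>\<open>X k\<close> is the common part of the summands at \<open>a\<close> and at
    \<open>a * q ^ 4\<close>, each of which becomes \<open>X k\<close> times a rational function of
    \<open>y k\<close>. The factor \<open>B k\<close> is kept apart because it makes the boundary
    term vanish in the terminating case.\<close>
  define W where "W k = q ^ (k ^ 2) * b k * A k / (q ^ (4 * k) * C k * D k * (1 - q))" for k
  define X where "X k = W k * B k" for k
  define c where "c = (1 - a * q) * (1 - a * q ^ 3)"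
  define g where "g k = q * (1 - a * q ^ 4) * (1 + a * q ^ 2) * (1 - y k ^ 2) * (a - y k ^ 2) * (q - y k) / c" for k
  have C0': "1 - a * q ^ j \<noteq> 0" if "j > 0" for j using C0[of "j - 1"] that by simp
  have E0': "1 + q ^ j \<noteq> 0" if "j > 0" for j using E0[of "j - 1"] that by simp
  have Q0': "1 - q ^ j \<noteq> 0" if "j > 0" for j using Q0[of "j - 1"] that by simp
  have D0': "a - q ^ (4 * j + 4) \<noteq> 0" for j using D0[of "Suc j"] by (simp add: add.commute)
  have c0: "1 - a * q \<noteq> 0" "1 - a * q ^ 3 \<noteq> 0" "c \<noteq> 0" "1 - a * q ^ 4 \<noteq> 0" "1 - q \<noteq> 0" "1 - a \<noteq> 0" "a - 1 \<noteq> 0"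
    using C0'[of 1] C0'[of 3] C0'[of 4] Q0'[of 1] D0[of 0] by (auto simp: c_def)
  have nz: "C k \<noteq> 0" "D k \<noteq> 0" "y k \<noteq> 0" for k
    using C0' D0' q0 by (auto simp: C_def D_def y_def)
  have y2: "q ^ (4 * k) = y k ^ 2" for k by (simp add: y_def flip: power_mult)
  have qterm_eq: "qterm q x k = q ^ (k ^ 2) * b k * ((1 - q * y k ^ 3) / (1 - q)) *
      ((\<Prod>j<k. 1 - x * q ^ (2 * j + 1)) * (\<Prod>j<k. x - q ^ (2 * j + 1)))
      / ((\<Prod>j<k. 1 - x * q ^ (4 * j + 4)) * (\<Prod>j<k. x - q ^ (4 * j + 4)))" for x k
  proof -
    have "qint q (6 * k + 1) = (1 - q * y k ^ 3) / (1 - q)"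
      using qint_mult[of q "6 * k + 1"] c0 by (simp add: y_def field_simps flip: power_mult)
    then show ?thesis
      by (simp add: qterm_def term_num_def term_den_def b_def num_factor_def den_factor_def prod.distrib mult_ac)
  qed
  have Bq: "(\<Prod>j<k. a - q ^ (2 * j + 1)) * y k ^ 2 * c = B k * ((a * q ^ 3 - y k) * (a * q - y k))" for k
  proof -
    have "(\<Prod>j<k. a - q ^ (2 * j + 1)) * y k ^ 2 = (\<Prod>j<k. q ^ 4 * (a - q ^ (2 * j + 1)))"
      by (simp add: prod.distrib y_def flip: power_mult)
    also have "\<dots> = (\<Prod>j<k. a * q ^ 4 - q ^ (2 * (j + 2) + 1))"
      by (intro prod.cong) (auto simp: algebra_simps power_add power_numeral_reduce)
    finally have "(\<Prod>j<k. a - q ^ (2 * j + 1)) * y k ^ 2 * ((a * q ^ 4 - q) * (a * q ^ 4 - q ^ 3))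
       = B k * ((a * q ^ 4 - q * y k) * (a * q ^ 4 - q ^ 3 * y k))"
      using prod_shift2[of "\<lambda>j. a * q ^ 4 - q ^ (2 * j + 1)" k]
      by (simp add: B_def y_def power_numeral_reduce mult_ac)
    moreover have "(a * q ^ 4 - q) * (a * q ^ 4 - q ^ 3) = q ^ 4 * c"
      unfolding c_def by algebra
    moreover have "(a * q ^ 4 - q * y k) * (a * q ^ 4 - q ^ 3 * y k) = q ^ 4 * ((a * q ^ 3 - y k) * (a * q - y k))"
      by algebra
    ultimately have "q ^ 4 * ((\<Prod>j<k. a - q ^ (2 * j + 1)) * y k ^ 2 * c)
       = q ^ 4 * (B k * ((a * q ^ 3 - y k) * (a * q - y k)))"
      by (simp only: mult_ac)
    then show ?thesis using q0 by simp
  qed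
  have Aq: "(\<Prod>j<k. 1 - a * q ^ 4 * q ^ (2 * j + 1)) * c = A k * ((1 - a * q * y k) * (1 - a * q ^ 3 * y k))" for k
    using prod_shift2[of "\<lambda>j. 1 - a * q ^ (2 * j + 1)" k]
    by (simp add: A_def y_def c_def power_numeral_reduce mult_ac)
  have Cq: "(\<Prod>j<k. 1 - a * q ^ 4 * q ^ (4 * j + 4)) * (1 - a * q ^ 4) = C k * (1 - a * q ^ 4 * y k ^ 2)" for k
    using prod_shift1[of "\<lambda>j. 1 - a * q ^ (4 * j + 4)" k]
    by (simp add: C_def y2[symmetric] power_add mult_ac)
  have Dq: "(\<Prod>j<k. a * q ^ 4 - q ^ (4 * j + 4)) * (a - y k ^ 2) = y k ^ 2 * D k * (a - 1)" for k
  proof -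
    have "(\<Prod>j<k. a * q ^ 4 - q ^ (4 * j + 4)) = (\<Prod>j<k. q ^ 4 * (a - q ^ (4 * j)))"
      by (intro prod.cong) (auto simp: algebra_simps power_add)
    also have "\<dots> = y k ^ 2 * (\<Prod>j<k. a - q ^ (4 * j))"
      by (simp add: prod.distrib y2[symmetric] flip: power_mult)
    finally show ?thesis
      using prod_shift1[of "\<lambda>j. a - q ^ (4 * j)" k] y2[of k]
      by (simp add: D_def mult_ac add.commute)
  qed
  have t1: "qterm q a k = X k * (1 - q * y k ^ 3) * ((a * q ^ 3 - y k) * (a * q - y k)) / c" for k
  proof -
    have "(\<Prod>j<k. a - q ^ (2 * j + 1)) = B k * ((a * q ^ 3 - y k) * (a * q - y k)) / (y k ^ 2 * c)"
      using Bq[of k] nz c0 by (simp add: field_simps)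
    then show ?thesis unfolding qterm_eq X_def W_def y2
      by (simp add: A_def C_def D_def mult_ac)
  qed
  have t2: "qterm q (a * q ^ 4) k = X k * (1 - q * y k ^ 3) * ((1 - a * q * y k) * (1 - a * q ^ 3 * y k))
      * (1 - a * q ^ 4) * (a - y k ^ 2) / (c * (1 - a * q ^ 4 * y k ^ 2) * (a - 1))" for k
  proof -
    have u: "1 - a * q ^ 4 * y k ^ 2 \<noteq> 0" "a - y k ^ 2 \<noteq> 0"
      using C0'[of "4 * k + 4"] D0[of k] by (auto simp: y2[symmetric] power_add mult_ac)
    have "(\<Prod>j<k. 1 - a * q ^ 4 * q ^ (2 * j + 1)) = A k * ((1 - a * q * y k) * (1 - a * q ^ 3 * y k)) / c"
      using Aq[of k] c0 by (simp add: field_simps)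
    moreover have "(\<Prod>j<k. 1 - a * q ^ 4 * q ^ (4 * j + 4)) = C k * (1 - a * q ^ 4 * y k ^ 2) / (1 - a * q ^ 4)"
      using Cq[of k] c0 by (metis nonzero_mult_div_cancel_right)
    moreover have "(\<Prod>j<k. a * q ^ 4 - q ^ (4 * j + 4)) = y k ^ 2 * D k * (a - 1) / (a - y k ^ 2)"
      using Dq[of k] u by (metis nonzero_mult_div_cancel_right)
    ultimately show ?thesis unfolding qterm_eq X_def W_def y2 B_def[symmetric]
      by (simp add: mult_ac)
  qed
  have XS: "X (Suc k) = X k * (y k * (1 - q ^ 2 * y k ^ 2) * (1 - a * q * y k) * (a * q ^ 3 - y k))
       / (q ^ 2 * (1 - q ^ 4 * y k ^ 2) * (1 - a * q ^ 4 * y k ^ 2) * (a - q ^ 4 * y k ^ 2))" for k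
  proof -
    define e where "e = 1 + q ^ 2 * y k"
    define f where "f = 1 - q ^ 2 * y k"
    have ef: "e \<noteq> 0" "f \<noteq> 0" using E0'[of "2 * k + 2"] Q0'[of "2 * k + 2"]
      by (auto simp: e_def f_def y_def power_add power2_eq_square mult_ac)
    have f4: "1 - q ^ 4 * y k ^ 2 = e * f" by (simp add: e_def f_def) algebra
    \<comment> \<open>One factor \<open>e\<close> cancels against the square in the denominator; the
      other joins \<open>f\<close> to form \<open>1 - q ^ 4 * y k ^ 2\<close>.\<close>
    have cancel: "e * w * z / f / (P * e ^ 2) = z / P * w / (e * f)" for w z P
      using ef by (simp add: power2_eq_square mult_ac)
    have g: "f * gbin (q ^ 2) (2 * Suc k) (Suc k) = e * (1 - q ^ 2 * y k ^ 2) * gbin (q ^ 2) (2 * k) k"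
      using gbin_central_Suc[of "q ^ 2" k]
      by (simp add: e_def f_def y_def mult_ac power_add flip: power_mult)
    have "b (Suc k) = gbin (q ^ 2) (2 * Suc k) (Suc k) / ((\<Prod>j<k. (1 + q ^ (2 * j + 2)) ^ 2) * e ^ 2)"
    proof -
      have "1 + q ^ (2 * k + 2) = e" by (simp add: e_def y_def power_add power2_eq_square mult_ac)
      then show ?thesis by (simp only: b_def prod.lessThan_Suc)
    qed
    also have "gbin (q ^ 2) (2 * Suc k) (Suc k) = e * (1 - q ^ 2 * y k ^ 2) * gbin (q ^ 2) (2 * k) k / f"
      using g ef by (simp add: field_simps)
    finally have bS: "b (Suc k) = b k * (1 - q ^ 2 * y k ^ 2) / (1 - q ^ 4 * y k ^ 2)"
      by (simp only: f4 cancel b_def[of k])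
    have AS: "A (Suc k) = A k * (1 - a * q * y k)" by (simp add: A_def y_def mult_ac)
    have BS: "B (Suc k) = B k * (q * (a * q ^ 3 - y k))"
      by (simp add: B_def y_def power_numeral_reduce algebra_simps)
    have CS: "C (Suc k) = C k * (1 - a * q ^ 4 * y k ^ 2)" by (simp add: C_def y2[symmetric] power_add mult_ac)
    have DS: "D (Suc k) = D k * (a - q ^ 4 * y k ^ 2)" by (simp add: D_def y2[symmetric] power_add mult_ac)
    have qS: "q ^ (Suc k ^ 2) = q ^ (k ^ 2) * (q * y k)"
    proof -
      have "Suc k ^ 2 = k ^ 2 + (1 + 2 * k)" by (simp add: power2_eq_square)
      then show ?thesis by (simp only: power_add y_def power_one_right)
    qed
    have q4: "q ^ (4 * Suc k) = q ^ (4 * k) * q ^ 4" by (simp add: power_add)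
    show ?thesis unfolding X_def W_def qS q4 bS AS BS CS DS using q0
      by (simp add: power_numeral_reduce divide_simps)
  qed
  have tel: "q ^ 2 * (1 - a) * qterm q (a * q ^ 4) k - (1 - a * q ^ 4) * qterm q a k
      = X (Suc k) * g (Suc k) - X k * g k" for k
  proof -
    define Y where "Y = y k"
    define u where "u = 1 - a * q ^ 4 * Y ^ 2"
    define v where "v = a - q ^ 4 * Y ^ 2"
    define w where "w = 1 - q ^ 4 * Y ^ 2"
    have nzs: "u \<noteq> 0" "v \<noteq> 0" "w \<noteq> 0"
      using C0'[of "4 * k + 4"] D0'[of k] Q0'[of "4 * k + 4"]
      by (auto simp: u_def v_def w_def Y_def y2[symmetric] power_add mult_ac)
    have yS: "y (Suc k) = q ^ 2 * Y" by (simp add: y_def Y_def power_add power2_eq_square)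
    have gS: "g (Suc k) = q ^ 2 * (1 - a * q ^ 4) * (1 + a * q ^ 2) * w * v * (1 - q * Y) / c"
      unfolding g_def yS w_def v_def by (simp add: power_mult_distrib power2_eq_square power_numeral_reduce algebra_simps)
    \<comment> \<open>This quotient is the origin of the minus sign in front of \<open>q ^ 2\<close>
      in \<open>telescoping_identity\<close>.\<close>
    have a1: "(1 - a) / (a - 1) = -1" using c0 by (simp add: divide_eq_eq)
    have L: "q ^ 2 * (1 - a) * qterm q (a * q ^ 4) k = X k * (1 - a * q ^ 4) / (c * u) *
       (- (q ^ 2) * (1 - q * Y ^ 3) * (1 - a * q * Y) * (1 - a * q ^ 3 * Y) * (a - Y ^ 2))"
    proof -
      have "q ^ 2 * (1 - a) * qterm q (a * q ^ 4) k = ((1 - a) / (a - 1)) * (X k * (1 - a * q ^ 4) / (c * u) *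
       ((q ^ 2) * (1 - q * Y ^ 3) * (1 - a * q * Y) * (1 - a * q ^ 3 * Y) * (a - Y ^ 2)))"
        unfolding t2 u_def Y_def by (simp add: mult_ac)
      then show ?thesis unfolding a1 by simp
    qed
    have M: "(1 - a * q ^ 4) * qterm q a k = X k * (1 - a * q ^ 4) / (c * u) *
       ((1 - q * Y ^ 3) * (a * q ^ 3 - Y) * (a * q - Y) * u)"
      unfolding t1 Y_def[symmetric] using nzs by (simp add: mult_ac)
    have R1: "X (Suc k) * g (Suc k) = X k * (1 - a * q ^ 4) / (c * u) *
       ((1 + a * q ^ 2) * (Y * (1 - q * Y) * (1 - q ^ 2 * Y ^ 2) * (1 - a * q * Y) * (a * q ^ 3 - Y)))"
      unfolding XS gS Y_def[symmetric] u_def[symmetric] v_def[symmetric] w_def[symmetric] using nzs q0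
      by (simp add: mult_ac)
    have R2: "X k * g k = X k * (1 - a * q ^ 4) / (c * u) *
       ((1 + a * q ^ 2) * (q * (1 - Y ^ 2) * (a - Y ^ 2) * (q - Y) * u))"
      unfolding g_def Y_def[symmetric] using nzs by (simp add: mult_ac)
    \<comment> \<open>Once the common prefactor \<open>X k * (1 - a * q ^ 4) / (c * u)\<close> is
      drawn out, \<open>telescoping_identity\<close> at \<open>y = q ^ (2 * k)\<close>
      remains.\<close>
    show ?thesis unfolding L M R1 R2 right_diff_distrib[symmetric]
      unfolding u_def telescoping_identity by (simp add: algebra_simps)
  qed
  have "q ^ 2 * (1 - a) * (\<Sum>k<K. qterm q (a * q ^ 4) k) - (1 - a * q ^ 4) * (\<Sum>k<K. qterm q a k)
      = (\<Sum>k<K. X (Suc k) * g (Suc k) - X k * g k)"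
    by (simp add: sum_distrib_left sum_subtractf flip: tel)
  also have "\<dots> = X K * g K - X 0 * g 0" by (rule sum_lessThan_telescope)
  \<comment> \<open>The lower boundary term drops out: \<open>y 0 = 1\<close>, so \<open>g 0\<close>
    contains the factor \<open>1 - y 0 ^ 2 = 0\<close>.\<close>
  also have "\<dots> = B K * (W K * g K)" by (simp add: g_def y_def X_def)
  finally show ?thesis unfolding B_def by blast
qed

subsection \<open>The terminating evaluation\<close>

text \<open>The region \<open>norm q > 1\<close> contains no roots of unity, so the denominators are
  nonzero there, and it is large enough to determine a polynomial in \<open>q\<close>.\<close>

lemma power_inj_norm:
  fixes q :: complex
  assumes "norm q > 1"
  shows "q ^ i = q ^ j \<longleftrightarrow> i = j"
  by (metis assms norm_power power_inject_exp)

lemma one_plus_power_nonzero: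
  fixes q :: complex
  assumes "norm q > 1" "j > 0"
  shows "1 + q ^ j \<noteq> 0"
proof
  assume "1 + q ^ j = 0"
  then have "norm (q ^ j) = 1" by (metis add_eq_0_iff norm_minus_cancel norm_one)
  then show False using assms by (metis norm_power one_less_power less_irrefl)
qed

text \<open>The factor with \<open>j = h\<close> contains \<open>a - q ^ (2 * h + 1) = 0\<close>;
  this is what makes the sum terminate after \<open>k = h\<close>.\<close>

lemma num_prod_eq_0:
  fixes q :: "'a::comm_ring_1"
  assumes "h < k"
  shows "(\<Prod>j<k. num_factor q (q ^ (2 * h + 1)) j) = 0"
proof -
  have "(\<Prod>j<k. num_factor q (q ^ (2 * h + 1)) j)
      = num_factor q (q ^ (2 * h + 1)) h * (\<Prod>j\<in>{..<k} - {h}. num_factor q (q ^ (2 * h + 1)) j)"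
    using assms by (intro prod.remove) auto
  then show ?thesis by (simp add: num_factor_def)
qed

lemma qterm_eq_0:
  fixes q :: "'a::field"
  shows "h < k \<Longrightarrow> qterm q (q ^ (2 * h + 1)) k = 0"
  by (simp only: qterm_def term_num_def num_prod_eq_0 mult_zero_right div_0)

lemma qterm_sum_extend:
  fixes q :: "'a::field"
  assumes "h < K" "h < L"
  shows "(\<Sum>k<K. qterm q (q ^ (2 * h + 1)) k) = (\<Sum>k<L. qterm q (q ^ (2 * h + 1)) k)"
proof -
  have "(\<Sum>k<K. qterm q (q ^ (2 * h + 1)) k) = (\<Sum>k<Suc h. qterm q (q ^ (2 * h + 1)) k)" if "h < K" for K
    using that by (intro sum.mono_neutral_right ballI qterm_eq_0) auto
  then show ?thesis using assms by metis
qed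

text \<open>The recurrence raises \<open>h\<close> by 2, so \<open>h = 0\<close> and
  \<open>h = 1\<close> are base cases. The factor \<open>q ^ h\<close> replaces the negative power
  of \<open>-q\<close>, and \<open>K\<close> is arbitrary so that both sums in the recurrence can
  have the same upper limit.\<close>

lemma qterm_sum_eval:
  fixes q :: complex
  assumes q: "norm q > 1"
  shows "h < K \<Longrightarrow> q ^ h * (\<Sum>k<K. qterm q (q ^ (2 * h + 1)) k) = (- 1) ^ h * qint q (2 * h + 1)"
proof (induction h arbitrary: K rule: less_induct)
  case (less h)
  have q0: "q \<noteq> 0" using q by auto
  have inj: "q ^ i = q ^ j \<longleftrightarrow> i = j" for i j by (rule power_inj_norm[OF q])
  have q1: "q ^ i = 1 \<longleftrightarrow> i = 0" for i using inj[of i 0] by simp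
  have qn1: "q \<noteq> 1" using q by auto
  consider "h = 0" | "h = 1" | g where "h = g + 2"
    by (metis One_nat_def add_2_eq_Suc' not0_implies_Suc)
  then show ?case
  proof cases
    case 1
    have "(\<Sum>k<K. qterm q (q ^ (2 * h + 1)) k) = (\<Sum>k<1. qterm q (q ^ (2 * h + 1)) k)"
      using less.prems 1 by (intro qterm_sum_extend) auto
    then show ?thesis using 1 by (simp add: qterm_def term_num_def term_den_def qint_def)
  next
    case 2
    \<comment> \<open>Only \<open>k = 0\<close> and \<open>k = 1\<close> contribute, and
      \<open>1 - (1 + q) ^ 2 / q = - (1 + q + q ^ 2) / q\<close>.\<close>
    have e: "(\<Sum>k<K. qterm q (q ^ (2 * h + 1)) k) = (\<Sum>k<2. qterm q (q ^ (2 * h + 1)) k)"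
      using less.prems 2 by (intro qterm_sum_extend) auto
    have z: "1 - q ^ 7 \<noteq> 0" "1 + q ^ 2 \<noteq> 0" "1 - q \<noteq> 0" "q ^ 3 - q ^ 4 \<noteq> 0"
      using q1[of 7] one_plus_power_nonzero[OF q, of 2] qn1 inj[of 3 4] by auto
    have c2: "gbin (q ^ 2) 2 1 = 1 + q ^ 2"
      by (simp add: numeral_2_eq_2)
    have "qint q 7 = (1 - q ^ 7) / (1 - q)"
      using qint_mult[of q 7] z by (simp add: field_simps)
    moreover have "qterm q (q ^ 3) 1 = q * qint q 7 * (1 + q ^ 2) * ((1 - q ^ 4) * (q ^ 3 - q))
       / ((1 - q ^ 7) * (q ^ 3 - q ^ 4) * (1 + q ^ 2) ^ 2)"
      using c2 by (simp add: qterm_def term_num_def term_den_def num_factor_def den_factor_def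
          flip: power_add power_Suc2) (simp add: power2_eq_square)
    ultimately have "qterm q (q ^ 3) 1 = q * ((1 - q ^ 7) / (1 - q)) * (1 + q ^ 2) * ((1 - q ^ 4) * (q ^ 3 - q))
       / ((1 - q ^ 7) * (q ^ 3 - q ^ 4) * (1 + q ^ 2) ^ 2)"
      by simp
    also have "\<dots> = q * (1 / (1 - q)) * ((1 - q ^ 4) * (q ^ 3 - q)) / ((q ^ 3 - q ^ 4) * (1 + q ^ 2))"
      using z by (simp add: divide_simps power2_eq_square)
    also have "\<dots> = - ((1 + q) ^ 2) / q"
    proof -
      have "q * ((1 - q ^ 4) * (q ^ 3 - q)) * q = - ((1 + q) ^ 2) * ((1 - q) * ((q ^ 3 - q ^ 4) * (1 + q ^ 2)))"
        by algebra
      moreover have "(1 - q) * ((q ^ 3 - q ^ 4) * (1 + q ^ 2)) \<noteq> 0" using z by simp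
      ultimately have "q * ((1 - q ^ 4) * (q ^ 3 - q)) / ((1 - q) * ((q ^ 3 - q ^ 4) * (1 + q ^ 2)))
          = - ((1 + q) ^ 2) / q"
        using q0 by (metis frac_eq_eq)
      then show ?thesis by simp
    qed
    finally have "q * (1 + qterm q (q ^ 3) 1) = q - (1 + q) ^ 2"
      using q0 by (simp add: field_simps)
    moreover have "qterm q (q ^ 3) 0 = 1" by (simp add: qterm_def term_num_def term_den_def qint_def)
    then have "(\<Sum>k<2. qterm q (q ^ 3) k) = 1 + qterm q (q ^ 3) 1" by (simp add: lessThan_nat_numeral)
    moreover have "qint q 3 = 1 + q + q ^ 2" by (simp add: qint_def lessThan_nat_numeral)
    moreover have "q ^ (2 * h + 1) = q ^ 3" "2 * h + 1 = 3" using 2 by simp_all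
    moreover have "q - (1 + q) ^ 2 = - 1 * (1 + q + q ^ 2)" by (simp add: power2_eq_square algebra_simps)
    ultimately show ?thesis unfolding e using 2 by (simp only: power_one_right)
  next
    case (3 g)
    define a where "a = q ^ (2 * g + 1)"
    have ah: "q ^ (2 * h + 1) = a * q ^ 4"
  proof -
    have "2 * h + 1 = 2 * g + 1 + 4" using 3 by simp
    then show ?thesis by (simp only: a_def power_add)
  qed
    define S where "S = (\<Sum>k<h + 2. qterm q (q ^ (2 * h + 1)) k)"
    define T where "T = (\<Sum>k<h + 2. qterm q a k)"
    have KS: "(\<Sum>k<K. qterm q (q ^ (2 * h + 1)) k) = S"
      unfolding S_def using less.prems by (intro qterm_sum_extend) auto
    have IH: "q ^ g * T = (- 1) ^ g * qint q (2 * g + 1)"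
      unfolding T_def a_def by (rule less.IH) (use 3 in auto)
    \<comment> \<open>The exponent of \<open>a\<close> as a power of \<open>q\<close> is odd, hence
      \<open>a - q ^ (4 * j)\<close> is nonzero as the recurrence requires.\<close>
    have "2 * g + 1 \<noteq> 4 * j" for j by presburger
    then have "\<exists>X. q ^ 2 * (1 - a) * (\<Sum>k<h+2. qterm q (a * q ^ 4) k) - (1 - a * q ^ 4) * (\<Sum>k<h+2. qterm q a k)
           = (\<Prod>j<h+2. a * q ^ 4 - q ^ (2 * j + 1)) * X"
      using q0 one_plus_power_nonzero[OF q]
      by (intro qterm_telescope) (auto simp: a_def inj q1 simp flip: power_add power_Suc)
    \<comment> \<open>The factor with \<open>j = h\<close> is zero because
      \<open>a * q ^ 4 = q ^ (2 * h + 1)\<close>, so the recurrence becomes homogeneous.\<close>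
    moreover have "(\<Prod>j<h+2. a * q ^ 4 - q ^ (2 * j + 1)) = 0"
      by (rule prod_zero) (auto simp: ah[symmetric] intro!: bexI[of _ h])
    ultimately have "q ^ 2 * (1 - a) * S - (1 - a * q ^ 4) * T = 0"
      unfolding S_def T_def ah by (metis mult_zero_left)
    then have "q ^ 2 * (1 - a) * S = (1 - a * q ^ 4) * T" by simp
    have q12: "(1 - q) * qint q (2 * g + 1) = 1 - a" "(1 - q) * qint q (2 * h + 1) = 1 - a * q ^ 4"
      by (simp_all only: qint_mult a_def ah)
    have "(1 - a) * (q ^ h * S) = q ^ g * (q ^ 2 * (1 - a) * S)"
      by (simp only: 3 power_add mult_ac)
    also have "\<dots> = (1 - a * q ^ 4) * (q ^ g * T)"
      by (subst \<open>q ^ 2 * (1 - a) * S = (1 - a * q ^ 4) * T\<close>) (simp only: mult_ac)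
    also have "\<dots> = (1 - a) * ((- 1) ^ g * qint q (2 * h + 1))"
      unfolding IH by (simp only: q12[symmetric] mult_ac)
    finally have "(1 - a) * (q ^ h * S) = (1 - a) * ((- 1) ^ g * qint q (2 * h + 1))" .
    moreover have "1 - a \<noteq> 0" using q1[of "2 * g + 1"] by (simp add: a_def)
    ultimately have "q ^ h * S = (- 1) ^ g * qint q (2 * h + 1)" by simp
    then show ?thesis unfolding KS using 3 by simp
  qed
qed

text \<open>One predicate serves evaluation in one and in two variables, the embedding of constants
  into polynomials and the embedding into the fraction field, so each expression is transferred by a
  single lemma.\<close>

definition ring_morphism :: "('a::comm_ring_1 \<Rightarrow> 'b::comm_ring_1) \<Rightarrow> bool" where
  "ring_morphism f \<longleftrightarrow> f 1 = 1 \<and> (\<forall>x y. f (x + y) = f x + f y) \<and> (\<forall>x y. f (x * y) = f x * f y)"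

context
  fixes f :: "'a::comm_ring_1 \<Rightarrow> 'b::comm_ring_1"
  assumes f: "ring_morphism f"
begin

lemma morphism_1: "f 1 = 1" and morphism_add: "f (x + y) = f x + f y" and morphism_mult: "f (x * y) = f x * f y"
  using f by (auto simp: ring_morphism_def)

lemma morphism_0: "f 0 = 0"
  using morphism_add[of 0 0] by simp

lemma morphism_minus: "f (- x) = - f x"
  using morphism_add[of x "- x"] morphism_0 by (simp add: eq_neg_iff_add_eq_0 add.commute)

lemma morphism_diff: "f (x - y) = f x - f y"
  using morphism_add[of x "- y"] morphism_minus by simp

lemma morphism_power: "f (x ^ n) = f x ^ n"
  by (induction n) (simp_all add: morphism_1 morphism_mult)

lemma morphism_sum: "f (sum g A) = (\<Sum>i\<in>A. f (g i))"
  by (induction A rule: infinite_finite_induct) (simp_all add: morphism_0 morphism_add)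

lemma morphism_prod: "f (prod g A) = (\<Prod>i\<in>A. f (g i))"
  by (induction A rule: infinite_finite_induct) (simp_all add: morphism_1 morphism_mult)

lemmas morphism_simps = morphism_0 morphism_1 morphism_add morphism_mult morphism_minus
  morphism_diff morphism_power morphism_sum morphism_prod

lemma morphism_gbin: "f (gbin x n k) = gbin (f x) n k"
  by (induction x n k rule: gbin.induct) (simp_all add: morphism_simps)

lemma morphism_qint: "f (qint q m) = qint (f q) m"
  by (simp add: qint_def morphism_simps)

lemma morphism_term_den: "f (term_den q a k) = term_den (f q) (f a) k"
  by (simp add: term_den_def den_factor_def morphism_simps)

lemma morphism_sum_num: "f (sum_num q a k) = sum_num (f q) (f a) k"
  by (simp add: sum_num_def term_num_def den_factor_def num_factor_def morphism_gbin morphism_qint morphism_simps)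

end

lemma ring_morphism_poly: "ring_morphism (\<lambda>p. poly p (x :: 'a::comm_ring_1))"
  by (simp add: ring_morphism_def)

section \<open>From \<open>norm q > 1\<close> to every complex \<open>q\<close>\<close>

lemma poly_eq_0_norm_gt_1:
  fixes p :: "complex poly"
  assumes "\<And>x. norm x > 1 \<Longrightarrow> poly p x = 0"
  shows "p = 0"
proof (rule ccontr)
  assume "p \<noteq> 0"
  then have "finite {x. poly p x = 0}" by (rule poly_roots_finite)
  moreover have "range (\<lambda>m. of_nat (m + 2) :: complex) \<subseteq> {x. poly p x = 0}"
  proof safe
    fix m :: nat
    have "norm (of_nat (m + 2) :: complex) > 1" by (subst norm_of_nat) simp
    then show "poly p (of_nat (m + 2)) = 0" by (rule assms)
  qed
  ultimately have "finite (range (\<lambda>m. of_nat (m + 2) :: complex))"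
    by (metis finite_subset)
  moreover have "inj (\<lambda>m. of_nat (m + 2) :: complex)" by (auto simp: inj_def)
  ultimately show False by (metis finite_imageD infinite_UNIV_nat)
qed

lemma term_den_nonzero:
  fixes q :: complex
  assumes "norm q > 1"
  shows "term_den q (q ^ (2 * h + 1)) K \<noteq> 0"
proof -
  have "2 * h + 1 \<noteq> 4 * j + 4" for j by presburger
  then show ?thesis
    using power_inj_norm[OF assms] power_inj_norm[OF assms, of _ 0] one_plus_power_nonzero[OF assms]
    by (auto simp: term_den_def den_factor_def simp flip: power_add power_Suc)
qed

lemma sum_num_eval_large:
  fixes q :: complex
  assumes "norm q > 1" "h \<le> K"
  shows "q ^ h * sum_num q (q ^ (2 * h + 1)) K = (- 1) ^ h * qint q (2 * h + 1) * term_den q (q ^ (2 * h + 1)) K"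
proof -
  have "sum_num q (q ^ (2 * h + 1)) K / term_den q (q ^ (2 * h + 1)) K = (\<Sum>k<Suc K. qterm q (q ^ (2 * h + 1)) k)"
    using sum_num_div[OF term_den_nonzero[OF assms(1)], of h K]
    by (simp add: qterm_def atLeast0AtMost lessThan_Suc_atMost)
  then have "sum_num q (q ^ (2 * h + 1)) K
      = (\<Sum>k<Suc K. qterm q (q ^ (2 * h + 1)) k) * term_den q (q ^ (2 * h + 1)) K"
    using term_den_nonzero[OF assms(1), of h K] by (metis nonzero_divide_eq_eq)
  then show ?thesis
    using qterm_sum_eval[OF assms(1), of h "Suc K"] assms(2)
    by (simp only: mult.assoc[symmetric] less_Suc_eq_le)
qed

text \<open>With denominators cleared, both sides are polynomials in \<open>q\<close> that agree for
  \<open>norm q > 1\<close>, hence everywhere. The case of interest is \<open>q\<close> a root of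
  unity, where \<open>term_den\<close> may vanish.\<close>

lemma sum_num_eval:
  fixes q :: complex
  assumes "h \<le> K"
  shows "q ^ h * sum_num q (q ^ (2 * h + 1)) K = (- 1) ^ h * qint q (2 * h + 1) * term_den q (q ^ (2 * h + 1)) K"
proof -
  define X :: "complex poly" where "X = [:0, 1:]"
  define p where "p = X ^ h * sum_num X (X ^ (2 * h + 1)) K
       - (- 1) ^ h * qint X (2 * h + 1) * term_den X (X ^ (2 * h + 1)) K"
  have p: "poly p x = x ^ h * sum_num x (x ^ (2 * h + 1)) K
       - (- 1) ^ h * qint x (2 * h + 1) * term_den x (x ^ (2 * h + 1)) K" for x
  proof -
    note [simp] = morphism_sum_num[OF ring_morphism_poly] morphism_term_den[OF ring_morphism_poly]
      morphism_qint[OF ring_morphism_poly]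
    show ?thesis by (simp add: p_def) (simp add: X_def)
  qed
  have "p = 0"
    using sum_num_eval_large[OF _ assms] by (intro poly_eq_0_norm_gt_1) (simp add: p)
  then show ?thesis using p[of q] by simp
qed

subsection \<open>Vanishing at roots of unity\<close>

lemma num_factor_inverse:
  fixes q a :: "'a::field"
  assumes "a \<noteq> 0"
  shows "num_factor q (inverse a) j * a ^ 2 = num_factor q a j"
  using assms by (simp add: num_factor_def field_simps power2_eq_square)

lemma den_factor_inverse:
  fixes q a :: "'a::field"
  assumes "a \<noteq> 0"
  shows "den_factor q (inverse a) j * a ^ 2 = den_factor q a j"
proof -
  have "(1 - inverse a * z) * (inverse a - z) * w * a ^ 2 = (1 - a * z) * (a - z) * w" for z w
    using assms by (simp add: field_simps power2_eq_square)
  then show ?thesis by (simp only: den_factor_def)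
qed

lemma term_den_inverse:
  fixes q a :: "'a::field"
  assumes "a \<noteq> 0"
  shows "term_den q (inverse a) K * a ^ (2 * K) = term_den q a K"
proof -
  have "term_den q (inverse a) K * a ^ (2 * K) = (\<Prod>j<K. den_factor q (inverse a) j * a ^ 2)"
    by (simp add: term_den_def prod.distrib power_mult)
  then show ?thesis by (simp add: term_den_def den_factor_inverse[OF assms])
qed

text \<open>Each summand has \<open>k\<close> numerator factors and \<open>K - k\<close> denominator
  factors involving \<open>a\<close>, and each of these \<open>K\<close> factors is reproduced by
  \<open>a ^ 2\<close> under \<open>a \<mapsto> 1 / a\<close>.\<close>

lemma sum_num_inverse:
  fixes q a :: "'a::field"
  assumes "a \<noteq> 0"
  shows "sum_num q (inverse a) K * a ^ (2 * K) = sum_num q a K"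
  unfolding sum_num_def sum_distrib_right
proof (intro sum.cong refl)
  fix k assume "k \<in> {0..K}"
  then have "2 * K = 2 * k + 2 * (K - k)" by auto
  then have "a ^ (2 * K) = a ^ (2 * k) * a ^ (2 * (K - k))" by (metis power_add)
  then have "a ^ (2 * K) = (\<Prod>j<k. a ^ 2) * (\<Prod>j=k..<K. a ^ 2)"
    by (simp add: power_mult)
  then have "term_num q (inverse a) k * (\<Prod>j=k..<K. den_factor q (inverse a) j) * a ^ (2 * K)
     = q ^ (k ^ 2) * qint q (6 * k + 1) * gbin (q ^ 2) (2 * k) k
        * ((\<Prod>j<k. num_factor q (inverse a) j) * (\<Prod>j<k. a ^ 2))
        * ((\<Prod>j=k..<K. den_factor q (inverse a) j) * (\<Prod>j=k..<K. a ^ 2))"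
    by (simp add: term_num_def mult_ac)
  then show "term_num q (inverse a) k * (\<Prod>j=k..<K. den_factor q (inverse a) j) * a ^ (2 * K)
     = term_num q a k * (\<Prod>j=k..<K. den_factor q a j)"
    by (simp only: prod.distrib[symmetric] num_factor_inverse[OF assms] den_factor_inverse[OF assms] term_num_def)
qed

lemma ring_morphism_const: "ring_morphism (\<lambda>c::'a::comm_ring_1. [:c:])"
  by (simp add: ring_morphism_def one_pCons)

text \<open>With \<open>q\<close> the constant \<open>[:z:]\<close> and \<open>a\<close> the
  variable, each summand is a constant times \<open>k + (K - k)\<close> factors of degree at most
  2.\<close>

lemma degree_sum_num:
  fixes z :: complex
  shows "degree (sum_num [:z:] [:0, 1:] K) \<le> 2 * K"
proof -
  have q: "degree [:a, b, c:] \<le> 2" for a b c :: complex by simp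
  have pw: "[:z:] ^ i = [:z ^ i:]" for i by (rule poly_const_pow)
  have N: "degree (num_factor [:z:] [:0, 1:] j) \<le> 2" for j
    unfolding num_factor_def pw by (simp add: one_pCons)
  have D: "degree (den_factor [:z:] [:0, 1:] j) \<le> 2" for j
  proof -
    have "den_factor [:z:] [:0, 1:] j = smult ((1 + z ^ (2 * j + 2)) ^ 2)
        ((1 - [:0, 1:] * [:z ^ (4 * j + 4):]) * ([:0, 1:] - [:z ^ (4 * j + 4):]))"
      unfolding den_factor_def pw by (simp add: one_pCons poly_const_pow mult.commute)
    moreover have "degree ((1 - [:0, 1:] * [:y:]) * ([:0, 1:] - [:y:])) \<le> 2" for y :: complex
      by (simp add: one_pCons)
    ultimately show ?thesis by (simp only: order.trans[OF degree_smult_le])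
  qed
  have C: "degree ([:z:] ^ i * qint [:z:] m * gbin ([:z:] ^ 2) n k) = 0" for i m n k
    unfolding pw morphism_qint[OF ring_morphism_const, symmetric] morphism_gbin[OF ring_morphism_const, symmetric]
    by simp
  have "degree (term_num [:z:] [:0, 1:] k * (\<Prod>j=k..<K. den_factor [:z:] [:0, 1:] j)) \<le> 2 * K" if "k \<le> K" for k
  proof -
    have "degree (\<Prod>j<k. num_factor [:z:] [:0, 1:] j) \<le> (\<Sum>j<k. 2)"
      by (rule order.trans[OF degree_prod_sum_le]) (auto intro!: sum_mono N simp del: sum_constant)
    then have "degree (term_num [:z:] [:0, 1:] k) \<le> 2 * k"
      unfolding term_num_def by (intro order.trans[OF degree_mult_le]) (simp add: C)
    moreover have "degree (\<Prod>j=k..<K. den_factor [:z:] [:0, 1:] j) \<le> (\<Sum>j=k..<K. 2)"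
      by (rule order.trans[OF degree_prod_sum_le]) (auto intro!: sum_mono D simp del: sum_constant)
    ultimately show ?thesis using that
      by (intro order.trans[OF degree_mult_le]) simp
  qed
  then show ?thesis unfolding sum_num_def by (intro degree_sum_le) auto
qed

lemma poly_sum_num: "poly (sum_num [:z:] [:0, 1:] K) a = sum_num z a K"
  by (simp add: morphism_sum_num[OF ring_morphism_poly])

section \<open>The half-period sum at a primitive root of unity\<close>

context
  fixes z :: complex and e :: nat
  assumes e: "odd e" "e > 1" and z: "z ^ e = 1" and prim: "\<And>i. 0 < i \<Longrightarrow> i < e \<Longrightarrow> z ^ i \<noteq> 1"
begin

lemma primitive_power_eq_1: "z ^ i = 1 \<longleftrightarrow> e dvd i"
proof -
  have "z ^ i = z ^ (i mod e) * (z ^ e) ^ (i div e)"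
    by (simp flip: power_mult power_add)
  then have "z ^ i = z ^ (i mod e)" by (simp add: z)
  then show ?thesis using prim[of "i mod e"] e by (cases "i mod e = 0") auto
qed

lemma primitive_nonzero: "z \<noteq> 0"
  using z e by (auto simp: power_0_left)

lemma primitive_neq_1: "z \<noteq> 1"
  using prim[of 1] e by auto

text \<open>For \<open>2 * h + 1 < e\<close> the right-hand side of the evaluation vanishes because of the common denominator,
  as \<open>4\<close> is invertible modulo \<open>e\<close>; for \<open>2 * h + 1 = e\<close> because of the q-integer.\<close>

lemma sum_num_at_power:
  assumes "2 * h + 1 \<le> e"
  shows "sum_num z (z ^ (2 * h + 1)) ((e - 1) div 2) = 0"
proof -
  define K where "K = (e - 1) div 2"
  have eK: "e = 2 * K + 1" using e by (auto simp: K_def)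
  have "qint z (2 * h + 1) * term_den z (z ^ (2 * h + 1)) K = 0"
  proof (cases "2 * h + 1 = e")
    case True
    then have "qint z (2 * h + 1) = 0"
      using qint_mult[of z e] z primitive_neq_1 by simp
    then show ?thesis by simp
  next
    case False
    define M where "M = 2 * h + 1"
    have M: "0 < M" "M < e" using False assms by (auto simp: M_def)
    \<comment> \<open>As \<open>e\<close> is odd, \<open>M + t * e\<close> meets every residue class
      modulo 4. The quotient \<open>s\<close> solves \<open>4 * s = M\<close> modulo
      \<open>e\<close> with \<open>0 < s < e\<close>.\<close>
    have "4 dvd M \<or> 4 dvd M + e \<or> 4 dvd M + 2 * e \<or> 4 dvd M + 3 * e"
      using e by presburger
    then obtain t s where ts: "t < 4" "M + t * e = 4 * s"
      by (auto elim!: dvdE intro: that[of 0] that[of 1] that[of 2] that[of 3])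
    have "t * e \<le> 3 * e" using ts by (intro mult_right_mono) auto
    then have s: "0 < s" "s < e" using ts M by linarith+
    have zs: "z ^ (4 * s) = z ^ M"
      unfolding ts(2)[symmetric] using z by (simp add: power_add power_mult mult.commute[of t])
    \<comment> \<open>If \<open>s \<le> K\<close>, the factor \<open>a - q ^ (4 * s)\<close>
      vanishes, at index \<open>s - 1\<close>. Otherwise \<open>e - s \<le> K\<close>, and
      \<open>1 - a * q ^ (4 * (e - s))\<close> vanishes, at index \<open>e - s - 1\<close>.\<close>
    have "\<exists>j<K. den_factor z (z ^ M) j = 0"
    proof (cases "s \<le> K")
      case True
      have "4 * (s - 1) + 4 = 4 * s" using s by simp
      then show ?thesis using True s zs by (intro exI[of _ "s - 1"]) (simp add: den_factor_def)
    next
      case False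
      have "4 * (e - s - 1) + 4 = 4 * (e - s)" using s by simp
      moreover have "z ^ M * z ^ (4 * (e - s)) = (z ^ e) ^ 4"
      proof -
        have "4 * s + 4 * (e - s) = e * 4" using s by simp
        then show ?thesis unfolding zs[symmetric] by (metis power_add power_mult)
      qed
      ultimately show ?thesis using False s eK z
        by (intro exI[of _ "e - s - 1"]) (simp add: den_factor_def)
    qed
    then show ?thesis unfolding term_den_def M_def by (auto intro!: prod_zero)
  qed
  moreover have "h \<le> K" using assms eK by simp
  ultimately have "z ^ h * sum_num z (z ^ (2 * h + 1)) K = 0"
    using sum_num_eval[of h K z] by (simp only: mult.assoc mult_zero_right)
  then show ?thesis using primitive_nonzero by (simp add: K_def)
qed

text \<open>As a polynomial in \<open>a\<close> of degree at most \<open>e - 1\<close> the sum has the \<open>e\<close> roots \<open>z ^ i\<close>; the even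
  exponents are reached through the symmetry \<open>a \<mapsto> 1 / a\<close>.\<close>

lemma sum_num_half_period: "sum_num z a ((e - 1) div 2) = 0"
proof -
  define K where "K = (e - 1) div 2"
  have eK: "e = 2 * K + 1" using e by (auto simp: K_def)
  define p where "p = sum_num [:z:] [:0, 1:] K"
  have root: "poly p (z ^ i) = 0" if "i < e" for i
  proof (cases "odd i")
    case True
    then show ?thesis using sum_num_at_power[of "i div 2"] that
      by (simp add: p_def K_def poly_sum_num)
  next
    case False
    then have "2 * ((e - i) div 2) + 1 = e - i" using that e by (simp add: odd_two_times_div_two_succ)
    then have "sum_num z (z ^ (e - i)) K = 0"
      using sum_num_at_power[of "(e - i) div 2"] that by (simp add: K_def)
    moreover have "z ^ i = inverse (z ^ (e - i))"
    proof -
      have "z ^ (e - i) * z ^ i = 1" using that z by (simp flip: power_add)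
      then show ?thesis by (metis inverse_unique)
    qed
    ultimately have "sum_num z (z ^ i) K * (z ^ (e - i)) ^ (2 * K) = 0"
      using sum_num_inverse[of "z ^ (e - i)" z K] primitive_nonzero by simp
    then show ?thesis using primitive_nonzero by (simp add: p_def poly_sum_num)
  qed
  have inj: "inj_on (\<lambda>i. z ^ i) {..<e}"
  proof (rule linorder_inj_onI')
    fix i j assume ij: "i \<in> {..<e}" "j \<in> {..<e}" "i < j"
    then have "z ^ j = z ^ i * z ^ (j - i)" by (simp flip: power_add)
    then show "z ^ i \<noteq> z ^ j" using prim[of "j - i"] ij primitive_nonzero by auto
  qed
  have "p = 0"
  proof (rule poly_eqI_degree)
    show "poly p x = poly 0 x" if "x \<in> (\<lambda>i. z ^ i) ` {..<e}" for x using that root by auto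
    show "card ((\<lambda>i. z ^ i) ` {..<e}) > degree p"
      using degree_sum_num[of z K] eK unfolding card_image[OF inj] p_def by simp
    show "card ((\<lambda>i. z ^ i) ` {..<e}) > degree (0 :: complex poly)"
      using e by (simp add: card_image[OF inj])
  qed
  then show ?thesis using poly_sum_num[of z K a] by (simp add: p_def K_def)
qed

section \<open>Block structure of the summand at a primitive root of unity\<close>

context
  fixes a :: complex
  assumes a: "norm a > 1"
begin

lemma norm_primitive: "norm z = 1"
proof -
  have "norm z ^ e = 1 ^ e" using z by (metis norm_one norm_power power_one)
  then show ?thesis using e by (intro power_eq_imp_eq_base[of "norm z" e 1]) auto
qed

text \<open>All powers of \<open>z\<close> have norm 1, whereas \<open>norm a > 1\<close>; and
  \<open>-1\<close> is no power of \<open>z\<close>, since its \<open>e\<close>-th power for odd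
  \<open>e\<close> is \<open>-1\<close>, not 1.\<close>

lemma unit_factors_nonzero: "1 - a * z ^ i \<noteq> 0" "a - z ^ i \<noteq> 0" "1 + z ^ i \<noteq> 0"
proof -
  have n: "norm (z ^ i) = 1" by (simp add: norm_power norm_primitive)
  show "1 - a * z ^ i \<noteq> 0"
  proof
    assume "1 - a * z ^ i = 0"
    then have "norm (a * z ^ i) = 1" by (metis eq_iff_diff_eq_0 norm_one)
    then show False using a n by (simp add: norm_mult)
  qed
  show "a - z ^ i \<noteq> 0" using a n by auto
  show "1 + z ^ i \<noteq> 0"
  proof
    assume "1 + z ^ i = 0"
    then have "z ^ i = -1" by (simp add: eq_neg_iff_add_eq_0 add.commute)
    then have "(z ^ i) ^ e = -1" using e by (simp add: power_minus_odd)
    moreover have "(z ^ i) ^ e = (z ^ e) ^ i" by (simp only: power_mult[symmetric] mult.commute)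
    then have "(z ^ i) ^ e = 1" using z by simp
    ultimately show False by simp
  qed
qed

lemma term_den_root_nonzero: "term_den z a k \<noteq> 0"
  using unit_factors_nonzero by (auto simp: term_den_def den_factor_def simp flip: power_Suc)

text \<open>The summand without its factor \<open>qint z (6 * k + 1)\<close>. That factor is
  periodic in \<open>k\<close>; the remaining part is the one multiplicative along blocks.\<close>

definition weight :: "nat \<Rightarrow> complex" where
  "weight k = z ^ (k ^ 2) * gbin (z ^ 2) (2 * k) k * (\<Prod>j<k. num_factor z a j) / term_den z a k"

lemma qterm_weight: "qterm z a k = weight k * qint z (6 * k + 1)"
  by (simp add: qterm_def weight_def term_num_def)

text \<open>The term ratio, cross-multiplied by \<open>1 - z ^ (4 * k + 4)\<close>, which is zero at
  the end of a block. It comes from \<open>gbin_central_Suc\<close> in base \<open>z ^ 2\<close>,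
  where \<open>1 + z ^ (2 * k + 2)\<close> is cancelled.\<close>

lemma weight_Suc:
  "weight (Suc k) * ((1 - z ^ (4 * k + 4)) * ((1 - a * z ^ (4 * k + 4)) * (a - z ^ (4 * k + 4))))
    = weight k * (z ^ (2 * k + 1) * (1 - z ^ (4 * k + 2)) * num_factor z a k)"
proof -
  define s where "s = 1 + z ^ (2 * k + 2)"
  define t where "t = 1 - z ^ (2 * k + 2)"
  define u where "u = (1 - a * z ^ (4 * k + 4)) * (a - z ^ (4 * k + 4))"
  define g where "g = gbin (z ^ 2) (2 * k) k"
  define g' where "g' = gbin (z ^ 2) (2 * Suc k) (Suc k)"
  have nz: "s \<noteq> 0" "u \<noteq> 0" "term_den z a k \<noteq> 0"
    using unit_factors_nonzero[of "2 * k + 2"] unit_factors_nonzero[of "4 * k + 4"] term_den_root_nonzero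
    by (auto simp: s_def u_def)
  have st: "1 - z ^ (4 * k + 4) = s * t"
  proof -
    have "4 * k + 4 = (2 * k + 2) * 2" by simp
    then have "z ^ (4 * k + 4) = (z ^ (2 * k + 2)) ^ 2" by (simp only: power_mult)
    then show ?thesis unfolding s_def t_def by (simp only: power2_eq_square) (simp add: algebra_simps)
  qed
  have G: "t * g' = s * (1 - z ^ (4 * k + 2)) * g"
  proof -
    have e: "(z ^ 2) ^ Suc k = z ^ (2 * k + 2)" "(z ^ 2) ^ Suc (2 * k) = z ^ (4 * k + 2)"
      by (simp_all only: power_mult[symmetric]) simp_all
    show ?thesis using gbin_central_Suc[of "z ^ 2" k] unfolding e s_def t_def g_def g'_def .
  qed
  have D: "term_den z a (Suc k) = term_den z a k * (u * s ^ 2)"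
    by (simp only: term_den_def prod.lessThan_Suc den_factor_def s_def u_def)
  have S: "z ^ (Suc k ^ 2) = z ^ (k ^ 2) * z ^ (2 * k + 1)"
  proof -
    have "Suc k ^ 2 = k ^ 2 + (2 * k + 1)" by (simp add: power2_eq_square)
    then show ?thesis by (simp only: power_add)
  qed
  have "weight (Suc k) * (s * t * u) = z ^ (k ^ 2) * z ^ (2 * k + 1) * (t * g') * ((\<Prod>j<k. num_factor z a j)
      * num_factor z a k) / (term_den z a k * s)"
    unfolding weight_def D S g'_def[symmetric] prod.lessThan_Suc using nz by (simp add: power2_eq_square)
  also have "\<dots> = weight k * (z ^ (2 * k + 1) * (1 - z ^ (4 * k + 2)) * num_factor z a k)"
    unfolding G weight_def g_def[symmetric] using nz by simp
  finally show ?thesis unfolding st u_def by (simp only: mult.assoc)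
qed

text \<open>\<open>e\<close> is coprime to 4 and does not divide \<open>Suc k\<close>, so
  \<open>z ^ (4 * k + 4)\<close> is not 1: inside a block the ratio determines the next
  weight.\<close>

lemma weight_Suc_cancel:
  assumes "Suc k < e"
  shows "(1 - z ^ (4 * k + 4)) * ((1 - a * z ^ (4 * k + 4)) * (a - z ^ (4 * k + 4))) \<noteq> 0"
proof -
  have "coprime e 2" using e by simp
  then have "coprime e (2 ^ 2)" by (simp only: coprime_power_right_iff simp_thms)
  then have "coprime e 4" by simp
  then have "\<not> e dvd 4 * Suc k"
    using assms by (metis coprime_dvd_mult_right_iff nat_dvd_not_less zero_less_Suc)
  then have "z ^ (4 * k + 4) \<noteq> 1" by (simp add: primitive_power_eq_1 add.commute del: power_Suc)
  then show ?thesis using unit_factors_nonzero by simp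
qed

text \<open>The ratio of consecutive weights depends on \<open>k\<close> only through powers of
  \<open>z\<close>, hence has period \<open>e\<close>; the induction starts from
  \<open>weight 0 = 1\<close> and stays inside one block.\<close>

lemma weight_block: "k < e \<Longrightarrow> weight (l * e + k) = weight (l * e) * weight k"
proof (induction k)
  case 0
  then show ?case by (simp add: weight_def term_den_def)
next
  case (Suc k)
  define c where "c i = (1 - z ^ (4 * i + 4)) * ((1 - a * z ^ (4 * i + 4)) * (a - z ^ (4 * i + 4)))" for i
  define d where "d i = z ^ (2 * i + 1) * (1 - z ^ (4 * i + 2)) * num_factor z a i" for i
  have per: "z ^ (m * (l * e + k) + j) = z ^ (m * k + j)" for m j
  proof -
    have "m * (l * e + k) + j = e * (m * l) + (m * k + j)" by (simp add: algebra_simps)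
    then show ?thesis by (simp only: power_add power_mult z power_one mult_1)
  qed
  have cd: "c (l * e + k) = c k" "d (l * e + k) = d k"
    unfolding c_def d_def num_factor_def per by simp_all
  have "weight (l * e + Suc k) * c k = weight (l * e + k) * d k"
    using weight_Suc[of "l * e + k"] by (fold c_def d_def) (simp add: cd)
  also have "\<dots> = weight (l * e) * (weight k * d k)" using Suc by simp
  also have "weight k * d k = weight (Suc k) * c k"
    using weight_Suc[of k] by (fold c_def d_def) simp
  finally show ?case using weight_Suc_cancel[of k] Suc.prems by (simp add: c_def)
qed

lemma qterm_block:
  assumes "k < e"
  shows "qterm z a (l * e + k) = weight (l * e) * qterm z a k"
proof -
  have "z ^ (6 * (l * e + k) + 1) = z ^ (6 * k + 1)"
  proof -
    have "6 * (l * e + k) + 1 = e * (6 * l) + (6 * k + 1)" by (simp add: algebra_simps)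
    then show ?thesis by (simp only: power_add power_mult z power_one mult_1)
  qed
  then have "(1 - z) * qint z (6 * (l * e + k) + 1) = (1 - z) * qint z (6 * k + 1)"
    by (simp only: qint_mult)
  then have "qint z (6 * (l * e + k) + 1) = qint z (6 * k + 1)"
    using primitive_neq_1 by simp
  then show ?thesis unfolding qterm_weight weight_block[OF assms] by simp
qed

text \<open>For \<open>K = (e - 1) div 2\<close> the exponent \<open>4 * K + 2\<close> is
  \<open>2 * e\<close>, so the ratio has a zero at \<open>K\<close>, and the zero propagates to the
  end of the block.\<close>

lemma weight_vanish:
  assumes "(e - 1) div 2 < k" "k < e"
  shows "weight k = 0"
proof -
  define K where "K = (e - 1) div 2"
  have "Suc K \<le> k" using assms by (simp add: K_def)
  then show ?thesis using assms(2)
  proof (induction k rule: dec_induct)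
    case base
    have "4 * K + 2 = 2 * e" using e by (auto simp: K_def elim!: oddE)
    then have "z ^ (4 * K + 2) = 1" using primitive_power_eq_1 by simp
    then show ?case using weight_Suc[of K] weight_Suc_cancel[OF base] by simp
  next
    case (step k)
    then show ?case using weight_Suc[of k] weight_Suc_cancel[of k] by simp
  qed
qed

lemma qterm_sum_half_period: "(\<Sum>k<Suc ((e - 1) div 2). qterm z a k) = 0"
  using sum_num_div[OF term_den_root_nonzero, of "(e - 1) div 2"] sum_num_half_period[of a]
  by (simp add: qterm_def atLeast0AtMost lessThan_Suc_atMost del: sum.lessThan_Suc)

lemma qterm_sum_period: "(\<Sum>k<e. qterm z a k) = 0"
proof -
  have "(\<Sum>k<e. qterm z a k) = (\<Sum>k<Suc ((e - 1) div 2). qterm z a k)"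
    using e by (intro sum.mono_neutral_right ballI) (auto simp: qterm_weight intro!: weight_vanish)
  then show ?thesis using qterm_sum_half_period by simp
qed

text \<open>Each complete block is a multiple of the vanishing sum over one period; only the last,
  partial block is left.\<close>

lemma qterm_sum_blocks:
  assumes "m \<le> e"
  shows "(\<Sum>k<l * e + m. qterm z a k) = weight (l * e) * (\<Sum>k<m. qterm z a k)"
proof -
  have block: "(\<Sum>k=l * e..<l * e + m. qterm z a k) = weight (l * e) * (\<Sum>k<m. qterm z a k)"
    if "m \<le> e" for l m
  proof -
    have "(\<Sum>k=l * e..<l * e + m. qterm z a k) = (\<Sum>k<m. qterm z a (l * e + k))"
      by (rule sum.reindex_bij_witness[of _ "\<lambda>k. l * e + k" "\<lambda>k. k - l * e"]) auto
    also have "\<dots> = (\<Sum>k<m. weight (l * e) * qterm z a k)"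
      using that by (intro sum.cong) (auto intro!: qterm_block)
    finally show ?thesis by (simp add: sum_distrib_left)
  qed
  have "(\<Sum>k<l * e. qterm z a k) = (\<Sum>i<l. \<Sum>k=i * e..<i * e + e. qterm z a k)"
    by (rule sum.nat_group[symmetric])
  also have "\<dots> = 0" by (simp add: block qterm_sum_period)
  finally have "(\<Sum>k<l * e. qterm z a k) = 0" .
  moreover have "(\<Sum>k<l * e + m. qterm z a k) = (\<Sum>k<l * e. qterm z a k) + (\<Sum>k=l * e..<l * e + m. qterm z a k)"
    unfolding lessThan_atLeast0 by (rule sum.atLeastLessThan_concat[symmetric]) auto
  ultimately show ?thesis using block[OF assms] by simp
qed

text \<open>For \<open>d = 1\<close> the \<open>N\<close> terms form complete blocks. For
  \<open>d = 2\<close>, writing \<open>N = e * (2 * l + 1)\<close> gives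
  \<open>(N - 1) div 2 = l * e + (e - 1) div 2\<close>, so the partial block is exactly a half
  period.\<close>

lemma sum_num_vanish_primitive:
  assumes N: "odd N" "e dvd N" and d: "d \<in> {1, 2}"
  shows "sum_num z a ((N - 1) div d) = 0"
proof -
  obtain L where L: "N = e * L" using N by blast
  have "odd L" using N L by auto
  have "\<exists>l m. Suc ((N - 1) div d) = l * e + m \<and> m \<le> e \<and> (\<Sum>k<m. qterm z a k) = 0"
  proof (cases "d = 1")
    case True
    then show ?thesis using L \<open>odd L\<close> e
      by (intro exI[of _ L] exI[of _ 0]) (simp add: mult.commute odd_pos)
  next
    case False
    obtain l where l: "L = 2 * l + 1" using \<open>odd L\<close> by (rule oddE)
    obtain K where K: "e = 2 * K + 1" using e by (auto elim: oddE)
    have "(N - 1) div 2 = l * e + K" unfolding L l by (subst (2) K) (simp add: algebra_simps K)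
    then show ?thesis using False d qterm_sum_half_period K
      by (intro exI[of _ l] exI[of _ "Suc K"]) auto
  qed
  then obtain l m where "Suc ((N - 1) div d) = l * e + m" "m \<le> e" "(\<Sum>k<m. qterm z a k) = 0"
    by blast
  then have "(\<Sum>k<Suc ((N - 1) div d). qterm z a k) = 0"
    using qterm_sum_blocks[of m l] by (simp only: mult_zero_right)
  then show ?thesis
    using sum_num_div[OF term_den_root_nonzero, of "(N - 1) div d"] term_den_root_nonzero[of "(N - 1) div d"]
    by (simp add: qterm_def atLeast0AtMost lessThan_Suc_atMost del: sum.lessThan_Suc)
qed

end
end

lemma sum_num_vanish:
  fixes z a :: complex
  assumes N: "odd N" and z: "z ^ N = 1" "z \<noteq> 1" and a: "norm a > 1" and d: "d \<in> {1, 2}"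
  shows "sum_num z a ((N - 1) div d) = 0"
proof -
  \<comment> \<open>\<open>e\<close> is the order of \<open>z\<close>; it divides \<open>N\<close>
    and is therefore odd.\<close>
  define e where "e = (LEAST i. 0 < i \<and> z ^ i = 1)"
  have "0 < N \<and> z ^ N = 1" using N z by (auto elim: oddE)
  then have e: "0 < e" "z ^ e = 1" unfolding e_def by (metis (mono_tags, lifting) LeastI)+
  have min: "z ^ i \<noteq> 1" if "0 < i" "i < e" for i
    using not_less_Least[of i "\<lambda>i. 0 < i \<and> z ^ i = 1"] that by (auto simp: e_def)
  have "z ^ N = z ^ (N mod e) * (z ^ e) ^ (N div e)" by (simp flip: power_mult power_add)
  then have "z ^ (N mod e) = 1" using z e by simp
  then have "e dvd N" using min[of "N mod e"] e by fastforce
  moreover from this have "odd e" using N by auto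
  moreover have "e > 1" using e z by (cases "e = 1") auto
  ultimately show ?thesis using sum_num_vanish_primitive[of e z a N d] e min a N d by auto
qed

subsection \<open>Divisibility in two variables\<close>

text \<open>Applied first to \<open>of_int\<close> and then to \<open>eval1\<close>, this yields
  evaluation of nested polynomials in \<open>q\<close> and \<open>a\<close>.\<close>

lemma ring_morphism_poly_map_poly:
  assumes g: "ring_morphism g"
  shows "ring_morphism (\<lambda>p. poly (map_poly g p) a)"
proof -
  note [simp] = morphism_simps[OF g]
  have P: "poly (map_poly g (pCons c p)) a = g c + a * poly (map_poly g p) a" for c p
    by (simp add: map_poly_pCons)
  have add: "poly (map_poly g (p + r)) a = poly (map_poly g p) a + poly (map_poly g r) a" for p r
    by (induction p r rule: poly_induct2) (simp_all add: P algebra_simps)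
  have smult: "poly (map_poly g (smult c p)) a = g c * poly (map_poly g p) a" for c p
    by (induction p) (simp_all add: P algebra_simps)
  have "poly (map_poly g (p * r)) a = poly (map_poly g p) a * poly (map_poly g r) a" for p r
    by (induction p) (simp_all add: P add smult algebra_simps)
  then show ?thesis unfolding ring_morphism_def using add by simp
qed

lemma ring_morphism_of_int: "ring_morphism (of_int :: int \<Rightarrow> 'a::comm_ring_1)"
  by (simp add: ring_morphism_def)

definition eval1 :: "complex \<Rightarrow> int poly \<Rightarrow> complex" where
  "eval1 q c = poly (map_poly of_int c) q"

definition eval2 :: "complex \<Rightarrow> complex \<Rightarrow> int poly poly \<Rightarrow> complex" where
  "eval2 q a p = poly (map_poly (eval1 q) p) a"

lemma ring_morphism_eval1: "ring_morphism (eval1 q)"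
  using ring_morphism_poly_map_poly[OF ring_morphism_of_int, of q] by (simp add: eval1_def[abs_def])

lemma ring_morphism_eval2: "ring_morphism (eval2 q a)"
  using ring_morphism_poly_map_poly[OF ring_morphism_eval1, of q a] by (simp add: eval2_def[abs_def])

lemma eval1_var: "eval1 q [:0, 1:] = q"
  by (simp add: eval1_def map_poly_pCons)

lemma eval2_pCons: "eval2 q a (pCons c p) = eval1 q c + a * eval2 q a p"
  by (simp add: eval2_def map_poly_pCons morphism_0[OF ring_morphism_eval1])

lemma eval2_0: "eval2 q a 0 = 0"
  by (rule morphism_0[OF ring_morphism_eval2])

lemma eval2_qvar: "eval2 q a qvar = q"
  by (simp add: qvar_def eval2_pCons eval1_var eval2_0)

lemma eval2_avar: "eval2 q a avar = a"
  by (simp add: avar_def eval2_pCons eval2_0 morphism_simps[OF ring_morphism_eval1])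

text \<open>Substituting a polynomial in \<open>q\<close> for \<open>a\<close> commutes with
  evaluation; thus a root in \<open>a\<close> over the integer polynomials can be detected by
  complex values.\<close>

lemma eval1_poly: "eval1 q (poly p c) = eval2 q (eval1 q c) p"
  by (induction p) (simp_all add: eval2_pCons eval2_0 morphism_simps[OF ring_morphism_eval1])

lemma eval1_eq_0:
  assumes "\<And>q. norm q > 1 \<Longrightarrow> eval1 q c = 0"
  shows "c = 0"
proof -
  have "map_poly of_int c = (0 :: complex poly)"
    using assms by (intro poly_eq_0_norm_gt_1) (simp add: eval1_def)
  then show ?thesis by (simp add: map_poly_eq_0_iff poly_eq_iff coeff_map_poly)
qed

lemma qvar_power: "qvar ^ s = [:[:0, 1:] ^ s:]"
  unfolding qvar_def by (rule poly_const_pow)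

lemma avar_minus_eq: "avar - qvar ^ s = [:- ([:0, 1:] ^ s), 1:]"
  by (simp add: qvar_power avar_def)

lemma one_minus_avar_eq: "1 - avar * qvar ^ s = [:1, - ([:0, 1:] ^ s):]"
  by (simp add: qvar_power avar_def one_pCons)

text \<open>By the factor theorem it suffices that \<open>p\<close> at \<open>a = q ^ s\<close>, a
  polynomial in \<open>q\<close> alone, vanishes; it does for all \<open>norm q > 1\<close>.\<close>

lemma avar_minus_dvd:
  assumes "\<And>q. norm q > 1 \<Longrightarrow> eval2 q (q ^ s) p = 0"
  shows "avar - qvar ^ s dvd p"
proof -
  have "poly p ([:0, 1:] ^ s) = 0"
    using assms by (intro eval1_eq_0) (simp add: eval1_poly morphism_power[OF ring_morphism_eval1] eval1_var)
  then show ?thesis by (simp only: avar_minus_eq poly_eq_0_iff_dvd)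
qed

text \<open>A divisor of a nonzero constant is itself constant, so it divides every coefficient of
  \<open>p\<close>, among them the coefficient 1.\<close>

lemma unit_if_dvd_const:
  fixes c p :: "'a::idom_divide poly"
  assumes "c dvd [:m:]" "m \<noteq> 0" "c dvd p" "coeff p i = 1"
  shows "is_unit c"
proof -
  have "degree c = 0" using dvd_imp_degree_le[OF assms(1)] assms(2) by simp
  then obtain c0 where c: "c = [:c0:]" by (rule degree_eq_zeroE)
  then have "c0 dvd 1" using assms(3,4) by (metis const_poly_dvd_iff)
  then show ?thesis by (simp add: c is_unit_const_poly_iff)
qed

text \<open>A substitute for a Bezout identity: the constant \<open>m\<close> need not be a unit,
  because a coefficient 1 of \<open>p\<close> excludes nonunit constants as divisors.\<close>

lemma coprime_if_combination:
  fixes p r :: "'a::idom_divide poly"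
  assumes "p * u + r * v = [:m:]" "m \<noteq> 0" "coeff p i = 1"
  shows "coprime p r"
proof (rule coprimeI)
  fix c assume "c dvd p" "c dvd r"
  then have "c dvd [:m:]" by (metis assms(1) dvd_add dvd_mult2)
  then show "is_unit c" using unit_if_dvd_const assms \<open>c dvd p\<close> by blast
qed

lemma X_power_eq_iff: "([:0, 1:] :: int poly) ^ s = [:0, 1:] ^ t \<longleftrightarrow> s = t"
proof
  assume "([:0, 1:] :: int poly) ^ s = [:0, 1:] ^ t"
  then have "degree (([:0, 1:] :: int poly) ^ s) = degree (([:0, 1:] :: int poly) ^ t)" by simp
  then show "s = t" by (simp add: degree_power_eq)
qed simp

text \<open>Eliminating \<open>a\<close> leaves \<open>q ^ t - q ^ s\<close> in the first two cases
  and \<open>1 - q ^ (s + t)\<close> in the third.\<close>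

lemma coprime_linear:
  "s \<noteq> t \<Longrightarrow> coprime (1 - avar * qvar ^ s) (1 - avar * qvar ^ t)"
  "s \<noteq> t \<Longrightarrow> coprime (avar - qvar ^ s) (avar - qvar ^ t)"
  "s + t > 0 \<Longrightarrow> coprime (1 - avar * qvar ^ s) (avar - qvar ^ t)"
proof -
  assume st: "s \<noteq> t"
  show "coprime (1 - avar * qvar ^ s) (1 - avar * qvar ^ t)"
  proof (rule coprime_if_combination)
    show "(1 - avar * qvar ^ s) * qvar ^ t + (1 - avar * qvar ^ t) * (- (qvar ^ s)) = [:[:0, 1:] ^ t - [:0, 1:] ^ s:]"
    proof -
      have "(1 - avar * qvar ^ s) * qvar ^ t + (1 - avar * qvar ^ t) * (- (qvar ^ s)) = qvar ^ t - qvar ^ s"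
        by (simp add: algebra_simps)
      then show ?thesis by (simp add: qvar_power)
    qed
    show "[:0, 1:] ^ t - [:0, 1:] ^ s \<noteq> (0 :: int poly)" using st X_power_eq_iff by auto
    show "coeff (1 - avar * qvar ^ s) 0 = 1" by (simp add: one_minus_avar_eq)
  qed
  show "coprime (avar - qvar ^ s) (avar - qvar ^ t)"
  proof (rule coprime_if_combination)
    show "(avar - qvar ^ s) * 1 + (avar - qvar ^ t) * (- 1) = [:[:0, 1:] ^ t - [:0, 1:] ^ s:]"
      by (simp add: qvar_power)
    show "[:0, 1:] ^ t - [:0, 1:] ^ s \<noteq> (0 :: int poly)" using st X_power_eq_iff by auto
    show "coeff (avar - qvar ^ s) 1 = 1" by (simp add: avar_minus_eq)
  qed
next
  assume st: "s + t > 0"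
  show "coprime (1 - avar * qvar ^ s) (avar - qvar ^ t)"
  proof (rule coprime_if_combination)
    show "(1 - avar * qvar ^ s) * 1 + (avar - qvar ^ t) * qvar ^ s = [:[:0, 1:] ^ 0 - [:0, 1:] ^ (s + t):]"
    proof -
      have "(1 - avar * qvar ^ s) * 1 + (avar - qvar ^ t) * qvar ^ s = qvar ^ 0 - qvar ^ (s + t)"
        by (simp add: algebra_simps power_add)
      then show ?thesis by (simp only: qvar_power) simp
    qed
    show "[:0, 1:] ^ 0 - [:0, 1:] ^ (s + t) \<noteq> (0 :: int poly)"
      using st X_power_eq_iff[of 0 "s + t"] by auto
    show "coeff (1 - avar * qvar ^ s) 0 = 1" by (simp add: one_minus_avar_eq)
  qed
qed

lemma coprime_linear_const:
  assumes "m \<noteq> 0"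
  shows "coprime [:m:] (1 - avar * qvar ^ s)" "coprime [:m:] (avar - qvar ^ s)"
proof -
  show "coprime [:m:] (1 - avar * qvar ^ s)"
  proof (rule coprimeI)
    fix c assume "c dvd [:m:]" "c dvd 1 - avar * qvar ^ s"
    then show "is_unit c" using assms unit_if_dvd_const[of c m "1 - avar * qvar ^ s" 0] by (simp add: one_minus_avar_eq)
  qed
  show "coprime [:m:] (avar - qvar ^ s)"
  proof (rule coprimeI)
    fix c assume "c dvd [:m:]" "c dvd avar - qvar ^ s"
    then show "is_unit c" using assms unit_if_dvd_const[of c m "avar - qvar ^ s" 1] by (simp add: avar_minus_eq)
  qed
qed

text \<open>Division by a polynomial whose constant rather than leading coefficient is a unit.\<close>

lemma reversed_division:
  fixes p :: "'a::comm_ring_1 poly"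
  shows "\<exists>m w r. [:c:] ^ m * p = (1 - [:0, 1:] * [:c:]) * w + [:r:]"
proof (induction p)
  case 0
  show ?case by (intro exI[of _ 0]) simp
next
  case (pCons b p)
  then obtain m w r where IH: "[:c:] ^ m * p = (1 - [:0, 1:] * [:c:]) * w + [:r:]" by blast
  have b: "pCons b p = [:b:] + [:0, 1:] * p" by simp
  have "[:c:] ^ Suc m * pCons b p = [:c ^ Suc m * b:] + [:0, 1:] * [:c:] * ([:c:] ^ m * p)"
    unfolding b by (simp add: poly_const_pow algebra_simps)
  also have "\<dots> = (1 - [:0, 1:] * [:c:]) * ([:0, 1:] * [:c:] * w - [:r:]) + ([:c ^ Suc m * b:] + [:r:])"
    unfolding IH by (simp only: algebra_simps mult_1_left)
  finally show ?case by (metis add_pCons add_0)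
qed

text \<open>The remainder of a power of \<open>q ^ s\<close> times \<open>p\<close> is free of
  \<open>a\<close> and vanishes, as seen at \<open>a = 1 / q ^ s\<close>. The power is then removed,
  being coprime to \<open>1 - a * q ^ s\<close>.\<close>

lemma one_minus_avar_dvd:
  assumes "\<And>q. norm q > 1 \<Longrightarrow> eval2 q (inverse (q ^ s)) p = 0"
  shows "1 - avar * qvar ^ s dvd p"
proof -
  obtain m w r where mwr: "(qvar ^ s) ^ m * p = (1 - avar * qvar ^ s) * w + [:r:]"
    using reversed_division[of "[:0, 1:] ^ s" p] by (auto simp: qvar_power avar_def)
  have "r = 0"
  proof (rule eval1_eq_0)
    fix q :: complex assume q: "norm q > 1"
    then have "q \<noteq> 0" by auto
    have "eval2 q (inverse (q ^ s)) ((qvar ^ s) ^ m * p)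
        = eval2 q (inverse (q ^ s)) ((1 - avar * qvar ^ s) * w + [:r:])" by (simp only: mwr)
    then show "eval1 q r = 0"
      using assms[OF q] \<open>q \<noteq> 0\<close>
      by (simp add: morphism_simps[OF ring_morphism_eval2] eval2_qvar eval2_avar eval2_pCons eval2_0)
  qed
  then have "1 - avar * qvar ^ s dvd (qvar ^ s) ^ m * p" using mwr by simp
  moreover have "coprime (1 - avar * qvar ^ s) ((qvar ^ s) ^ m)"
    using coprime_linear_const(1)[of "([:0, 1:] ^ s) ^ m" s]
    by (simp add: qvar_power poly_const_pow coprime_commute)
  ultimately show ?thesis using coprime_dvd_mult_right_iff by blast
qed

text \<open>The remainder of \<open>c\<close> modulo the q-integer has degree below
  \<open>N - 1\<close> but vanishes at the \<open>N - 1\<close> roots of unity other than 1.\<close>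

lemma qint_X_dvd:
  fixes c :: "int poly"
  assumes N: "N > 0" and c: "\<And>z. z ^ N = 1 \<Longrightarrow> z \<noteq> 1 \<Longrightarrow> eval1 z c = 0"
  shows "qint [:0, 1:] N dvd c"
proof -
  define g :: "int poly" where "g = qint [:0, 1:] N"
  have "[:0, 1:] ^ j = monom (1 :: int) j" for j by (simp add: monom_altdef)
  then have cg: "coeff g i = (if i < N then 1 else 0)" for i
    by (simp add: g_def qint_def coeff_sum sum.delta)
  have dg: "degree g = N - 1"
    using N by (intro antisym degree_le le_degree) (auto simp: cg)
  have lg: "lead_coeff g = 1" using N by (simp add: dg cg)
  then have "g \<noteq> 0" by auto
  obtain u r where ur: "pseudo_divmod c g = (u, r)" by fastforce
  \<comment> \<open>Since \<open>g\<close> is monic, pseudo-division is genuine division with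
    integer coefficients.\<close>
  have div: "c = g * u + r" "r = 0 \<or> degree r < degree g"
    using pseudo_divmod[OF \<open>g \<noteq> 0\<close> ur] lg by simp_all
  have "r = 0"
  proof (rule ccontr)
    assume "r \<noteq> 0"
    define R :: "complex poly" where "R = map_poly of_int r"
    have R0: "R \<noteq> 0" using \<open>r \<noteq> 0\<close> by (simp add: R_def map_poly_eq_0_iff poly_eq_iff coeff_map_poly)
    have "poly R z = 0" if z: "z ^ N = 1" "z \<noteq> 1" for z
    proof -
      have "(1 - z) * eval1 z g = 0"
        using qint_mult[of z N] z by (simp add: g_def morphism_qint[OF ring_morphism_eval1] eval1_var)
      then have "eval1 z g = 0" using z by simp
      then have "eval1 z r = 0"
        using c[OF z] unfolding div(1) by (simp add: morphism_simps[OF ring_morphism_eval1])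
      then show ?thesis by (simp add: R_def eval1_def)
    qed
    then have "{z. z ^ N = 1} - {1} \<subseteq> {z. poly R z = 0}" by auto
    then have "card ({z::complex. z ^ N = 1} - {1}) \<le> card {z. poly R z = 0}"
      by (intro card_mono poly_roots_finite R0)
    also have "\<dots> \<le> degree R" using R0 by (rule card_poly_roots_bound)
    also have "\<dots> \<le> degree r" unfolding R_def by (rule map_poly_degree_leq)
    also have "\<dots> < N - 1" using div(2) \<open>r \<noteq> 0\<close> dg by simp
    also have "N - 1 = card ({z::complex. z ^ N = 1} - {1})"
      using card_roots_unity_eq[of N] N by (subst card_Diff_singleton) auto
    finally show False by simp
  qed
  then show ?thesis using div(1) by (simp add: g_def)
qed

lemma qint_qvar: "qint qvar N = [:qint [:0, 1:] N:]"
  unfolding qvar_def by (rule morphism_qint[OF ring_morphism_const, symmetric])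

text \<open>At a fixed root of unity, \<open>p\<close> as a polynomial in \<open>a\<close> has
  infinitely many zeros, so all its coefficients vanish there and \<open>qint_X_dvd\<close> applies
  to each.\<close>

lemma qint_qvar_dvd:
  assumes N: "N > 0" and p: "\<And>z a. z ^ N = 1 \<Longrightarrow> z \<noteq> 1 \<Longrightarrow> norm a > 1 \<Longrightarrow> eval2 z a p = 0"
  shows "qint qvar N dvd p"
proof -
  have "qint [:0, 1:] N dvd coeff p i" for i
  proof (rule qint_X_dvd[OF N])
    fix z :: complex assume z: "z ^ N = 1" "z \<noteq> 1"
    have "map_poly (eval1 z) p = 0"
      using p[OF z] by (intro poly_eq_0_norm_gt_1) (simp add: eval2_def)
    then have "coeff (map_poly (eval1 z) p) i = 0" by simp
    then show "eval1 z (coeff p i) = 0"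
      by (simp add: coeff_map_poly morphism_0[OF ring_morphism_eval1])
  qed
  then show ?thesis by (simp add: qint_qvar const_poly_dvd_iff)
qed

section \<open>Products of coprime factors and the q-integer\<close>

lemma prod_dvd_if_coprime:
  fixes f :: "'b \<Rightarrow> 'a::semiring_gcd"
  assumes "finite A" "\<And>i. i \<in> A \<Longrightarrow> f i dvd p" "\<And>i j. i \<in> A \<Longrightarrow> j \<in> A \<Longrightarrow> i \<noteq> j \<Longrightarrow> coprime (f i) (f j)"
  shows "prod f A dvd p"
  using assms
proof (induction A rule: finite_induct)
  case (insert x A)
  then have "coprime (f x) (prod f A)" by (intro prod_coprime_right) auto
  then show ?case using insert by (simp add: divides_mult)
qed simp

lemma qint_Suc: "qint p (Suc m) = 1 + p * qint p m"
  unfolding qint_def sum.lessThan_Suc_shift by (simp add: sum_distrib_left)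

lemma qint_nonzero: "m > 0 \<Longrightarrow> qint [:0, 1:] m \<noteq> (0 :: int poly)"
proof
  assume "m > 0" "qint [:0, 1:] m = (0 :: int poly)"
  then have "poly (qint [:0, 1:] m) (1 :: int) = 0" by simp
  then show False using \<open>m > 0\<close>
    by (simp add: morphism_qint[OF ring_morphism_poly]) (simp add: qint_def)
qed

lemma coprime_qvar_qint: "N > 0 \<Longrightarrow> coprime qvar (qint qvar N)"
proof (rule coprimeI)
  fix c assume "N > 0" "c dvd qvar" "c dvd qint qvar N"
  then obtain m where "c dvd 1 + qvar * qint qvar m" by (metis gr0_implies_Suc qint_Suc)
  then show "is_unit c" using \<open>c dvd qvar\<close> by (simp add: dvd_add_left_iff)
qed

text \<open>A common divisor, which is constant in \<open>a\<close>, divides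
  \<open>1 - X ^ (N * u)\<close> through the q-integer and, \<open>N\<close> being odd,
  \<open>1 + X ^ (N * u)\<close> through \<open>1 + X ^ u\<close>. Hence it divides 2, and the
  constant term 1 of \<open>1 + X ^ u\<close> makes it a unit.\<close>

lemma coprime_one_plus_qint:
  assumes "odd N" "u > 0"
  shows "coprime (1 + qvar ^ u) (qint qvar N)"
proof (rule coprimeI)
  define X :: "int poly" where "X = [:0, 1:]"
  have u: "1 + qvar ^ u = [:1 + X ^ u:]" by (simp add: qvar_power X_def one_pCons)
  have c0: "coeff (1 + X ^ u) 0 = 1"
    using assms by (simp add: X_def coeff_0_power power_0_left)
  fix c assume c: "c dvd 1 + qvar ^ u" "c dvd qint qvar N"
  have nz: "1 + X ^ u \<noteq> 0" using c0 by (metis coeff_0 zero_neq_one)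
  have "degree c = 0" using dvd_imp_degree_le[OF c(1)] nz by (simp add: u)
  then obtain b where cb: "c = [:b:]" by (rule degree_eq_zeroE)
  have b: "b dvd 1 + X ^ u" "b dvd qint X N"
    using c by (simp_all add: cb u qint_qvar X_def)
  have "b dvd 1 - X ^ N" by (metis b(2) dvd_mult qint_mult)
  then have "b dvd 1 - (X ^ N) ^ u" by (metis dvd_mult2 qint_mult)
  moreover have "b dvd 1 - (- (X ^ u)) ^ N"
    using b(1) by (metis diff_minus_eq_add dvd_mult2 qint_mult)
  then have "b dvd 1 + (X ^ N) ^ u"
    using assms by (simp add: power_minus_odd mult.commute flip: power_mult)
  ultimately have "b dvd (1 - (X ^ N) ^ u) + (1 + (X ^ N) ^ u)" by (rule dvd_add)
  then have "b dvd [:2:]" by (simp add: numeral_poly)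
  then have "is_unit b" using b(1) c0 by (intro unit_if_dvd_const[of b 2 "1 + X ^ u" 0]) auto
  then show "is_unit c" by (simp add: cb is_unit_const_poly_iff)
qed

subsection \<open>The congruence\<close>

text \<open>With \<open>full_num\<close>, the difference of the two sides over one denominator. The
  power \<open>q ^ ((n - 1) div 2)\<close> clears the negative power of \<open>-q\<close>, whose
  sign goes into \<open>full_num\<close>.\<close>

definition full_den :: "nat \<Rightarrow> nat \<Rightarrow> nat \<Rightarrow> 'a::comm_ring_1 \<Rightarrow> 'a \<Rightarrow> 'a" where
  "full_den n K L q a = q ^ ((n - 1) div 2) * term_den q a K * term_den (q ^ n) a L"

definition full_num :: "nat \<Rightarrow> nat \<Rightarrow> nat \<Rightarrow> 'a::comm_ring_1 \<Rightarrow> 'a \<Rightarrow> 'a" where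
  "full_num n K L q a = q ^ ((n - 1) div 2) * sum_num q a K * term_den (q ^ n) a L
     - (- 1) ^ ((n - 1) div 2) * qint q n * sum_num (q ^ n) a L * term_den q a K"

lemma morphism_full_den: "ring_morphism f \<Longrightarrow> f (full_den n K L q a) = full_den n K L (f q) (f a)"
  by (simp add: full_den_def morphism_simps morphism_term_den)

lemma morphism_full_num: "ring_morphism f \<Longrightarrow> f (full_num n K L q a) = full_num n K L (f q) (f a)"
  by (simp add: full_num_def morphism_simps morphism_term_den morphism_sum_num morphism_qint)

lemma qint_qint: "qint q n * qint (q ^ n) m = qint q (n * m)"
  for q :: complex
proof (cases "q = 1")
  case False
  have "(1 - q) * (qint q n * qint (q ^ n) m) = (1 - q) * qint q (n * m)"
    by (simp only: qint_mult mult.assoc[symmetric] power_mult)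
  then show ?thesis using False by simp
qed (simp add: qint_def)

text \<open>Both sums terminate: in base \<open>q\<close> the parameter is the power
  \<open>(2 * j + 1) * n\<close>, in base \<open>q ^ n\<close> the power \<open>2 * j + 1\<close>.
  The two evaluations agree because
  \<open>qint q n * qint (q ^ n) m = qint q (n * m)\<close>.\<close>

lemma full_num_at_power:
  fixes q :: complex
  assumes q: "q \<noteq> 0" and n: "odd n" and j: "j \<le> L" and s: "((2 * j + 1) * n - 1) div 2 \<le> K"
  shows "full_num n K L q (q ^ ((2 * j + 1) * n)) = 0"
proof -
  define h where "h = (n - 1) div 2"
  define a where "a = q ^ ((2 * j + 1) * n)"
  have nh: "n = 2 * h + 1" using n by (auto simp: h_def elim!: oddE)
  have sh: "(2 * j + 1) * n = 2 * (n * j + h) + 1" using nh by (simp add: algebra_simps)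
  have hK: "n * j + h \<le> K" using s unfolding sh by simp
  have E1: "q ^ (n * j + h) * sum_num q a K = (- 1) ^ (n * j + h) * qint q ((2 * j + 1) * n) * term_den q a K"
    using sum_num_eval[OF hK, of q] unfolding a_def sh .
  have a2: "a = (q ^ n) ^ (2 * j + 1)" unfolding a_def by (simp only: power_mult[symmetric] mult.commute)
  have E2: "q ^ (n * j) * sum_num (q ^ n) a L = (- 1) ^ j * qint (q ^ n) (2 * j + 1) * term_den (q ^ n) a L"
    using sum_num_eval[OF j, of "q ^ n"] unfolding a2 by (simp only: power_mult)
  \<comment> \<open>\<open>(-1) ^ (n * j) = (-1) ^ j\<close> because \<open>n\<close> is
    odd.\<close>
  have sgn: "(- 1 :: complex) ^ (n * j + h) = (- 1) ^ h * (- 1) ^ j"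
    using n by (simp add: power_add power_mult)
  have Q: "qint q ((2 * j + 1) * n) = qint q n * qint (q ^ n) (2 * j + 1)"
    by (simp only: qint_qint mult.commute)
  have "q ^ (n * j) * full_num n K L q a
     = (q ^ (n * j + h) * sum_num q a K) * term_den (q ^ n) a L
       - (- 1) ^ h * qint q n * (q ^ (n * j) * sum_num (q ^ n) a L) * term_den q a K"
    unfolding full_num_def h_def[symmetric] by (simp add: power_add algebra_simps)
  also have "\<dots> = 0" unfolding E1 E2 sgn Q by (simp add: mult_ac)
  finally show ?thesis using q by (simp add: a_def)
qed

text \<open>Both products in \<open>full_num\<close> are reproduced by
  \<open>a ^ (2 * K + 2 * L)\<close>, so its zeros at powers of \<open>q\<close> give those at the
  inverse powers.\<close>

lemma full_num_inverse:
  fixes q a :: "'a::field"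
  assumes a: "a \<noteq> 0" and z: "full_num n K L q a = 0"
  shows "full_num n K L q (inverse a) = 0"
proof -
  have "full_num n K L q (inverse a) * (a ^ (2 * K) * a ^ (2 * L))
     = q ^ ((n - 1) div 2) * (sum_num q (inverse a) K * a ^ (2 * K)) * (term_den (q ^ n) (inverse a) L * a ^ (2 * L))
     - (- 1) ^ ((n - 1) div 2) * qint q n * (sum_num (q ^ n) (inverse a) L * a ^ (2 * L)) * (term_den q (inverse a) K * a ^ (2 * K))"
    unfolding full_num_def by (simp add: algebra_simps)
  also have "\<dots> = full_num n K L q a"
    unfolding sum_num_inverse[OF a] term_den_inverse[OF a] full_num_def ..
  finally show ?thesis using a z by simp
qed

text \<open>Both products vanish separately. In the second, either \<open>z ^ n = 1\<close>, so that
  \<open>qint z n = 0\<close>, or \<open>z ^ n\<close> is a root of unity other than 1 of order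
  dividing \<open>n ^ (r - 1)\<close>.\<close>

lemma full_num_root_of_unity:
  fixes z a :: complex
  assumes n: "odd n" and r: "r \<ge> 1" and d: "d \<in> {1, 2}" and z: "z ^ (n ^ r) = 1" "z \<noteq> 1" and a: "norm a > 1"
  shows "full_num n ((n ^ r - 1) div d) ((n ^ (r - 1) - 1) div d) z a = 0"
proof -
  have "sum_num z a ((n ^ r - 1) div d) = 0"
    using n z a d by (intro sum_num_vanish) auto
  moreover have "qint z n * sum_num (z ^ n) a ((n ^ (r - 1) - 1) div d) = 0"
  proof (cases "z ^ n = 1")
    case True
    then show ?thesis using qint_mult[of z n] z by simp
  next
    case False
    have "n ^ r = n * n ^ (r - 1)" using r by (cases r) auto
    then have "(z ^ n) ^ (n ^ (r - 1)) = 1" using z by (simp flip: power_mult)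
    then have "sum_num (z ^ n) a ((n ^ (r - 1) - 1) div d) = 0"
      using False n a d by (intro sum_num_vanish) auto
    then show ?thesis by simp
  qed
  ultimately show ?thesis by (auto simp: full_num_def)
qed

text \<open>With \<open>x = q ^ 2\<close>, the central coefficient is
  \<open>(x;x)_2k / (x;x)_k ^ 2\<close>; here \<open>(x;x)_2k = (x;x^2)_k (x^2;x^2)_k\<close>, and
  \<open>(x^2;x^2)_k\<close> is \<open>(x;x)_k\<close> times the product of the
  \<open>1 + x ^ j\<close>. Induction avoids the division.\<close>

lemma qpoch_qfact_ratio:
  "qpoch (q ^ 2) (q ^ 4) k * (\<Prod>j<k. (1 + q ^ (2 * j + 2)) ^ 2) = gbin (q ^ 2) (2 * k) k * qpoch (q ^ 4) (q ^ 4) k"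
proof (induction k)
  case 0
  then show ?case by (simp add: qpoch_def)
next
  case (Suc k)
  define s where "s = 1 + q ^ (2 * k + 2)"
  define t where "t = 1 - q ^ (2 * k + 2)"
  have st: "1 - q ^ 4 * (q ^ 4) ^ k = s * t"
  proof -
    have "4 + 4 * k = (2 * k + 2) * 2" by simp
    then have "q ^ 4 * (q ^ 4) ^ k = (q ^ (2 * k + 2)) ^ 2"
      by (simp only: power_mult[symmetric] power_add[symmetric])
    then show ?thesis unfolding s_def t_def by (simp only: power2_eq_square) (simp add: algebra_simps)
  qed
  have G: "t * gbin (q ^ 2) (2 * Suc k) (Suc k) = s * (1 - q ^ 2 * (q ^ 4) ^ k) * gbin (q ^ 2) (2 * k) k"
  proof -
    have "2 * Suc k = 2 * k + 2" "2 * Suc (2 * k) = 2 + 4 * k" by simp_all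
    then have e: "(q ^ 2) ^ Suc k = q ^ (2 * k + 2)" "(q ^ 2) ^ Suc (2 * k) = q ^ 2 * (q ^ 4) ^ k"
      by (simp_all only: power_mult[symmetric] power_add[symmetric])
    show ?thesis using gbin_central_Suc[of "q ^ 2" k] unfolding e s_def t_def .
  qed
  have "qpoch (q ^ 2) (q ^ 4) (Suc k) * (\<Prod>j<Suc k. (1 + q ^ (2 * j + 2)) ^ 2)
     = (qpoch (q ^ 2) (q ^ 4) k * (\<Prod>j<k. (1 + q ^ (2 * j + 2)) ^ 2)) * ((1 - q ^ 2 * (q ^ 4) ^ k) * s ^ 2)"
    by (simp only: qpoch_def prod.lessThan_Suc s_def mult_ac)
  also have "\<dots> = s * (s * (1 - q ^ 2 * (q ^ 4) ^ k) * gbin (q ^ 2) (2 * k) k) * qpoch (q ^ 4) (q ^ 4) k"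
    unfolding Suc.IH by (simp only: power2_eq_square mult_ac)
  also have "\<dots> = gbin (q ^ 2) (2 * Suc k) (Suc k) * (qpoch (q ^ 4) (q ^ 4) k * (s * t))"
    unfolding G[symmetric] by (simp only: mult_ac)
  also have "\<dots> = gbin (q ^ 2) (2 * Suc k) (Suc k) * qpoch (q ^ 4) (q ^ 4) (Suc k)"
    by (simp only: qpoch_def prod.lessThan_Suc st)
  finally show ?case .
qed

lemma qterm_qpoch:
  fixes q a :: "'a::field"
  assumes a: "a \<noteq> 0" and D: "term_den q a k \<noteq> 0" and Q: "\<And>j. 1 - q ^ Suc j \<noteq> 0"
  shows "q ^ (k ^ 2) * qint q (6 * k + 1) *
        (qpoch (a * q) (q ^ 2) k * qpoch (q / a) (q ^ 2) k * qpoch (q ^ 2) (q ^ 4) k)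
        / (qpoch (a * q ^ 4) (q ^ 4) k * qpoch (q ^ 4 / a) (q ^ 4) k * qpoch (q ^ 4) (q ^ 4) k)
      = qterm q a k"
proof -
  define E where "E = (\<Prod>j<k. (1 + q ^ (2 * j + 2)) ^ 2)"
  define G where "G = gbin (q ^ 2) (2 * k) k"
  define A where "A = qpoch (a * q) (q ^ 2) k"
  define B where "B = qpoch (q / a) (q ^ 2) k"
  define C where "C = qpoch (a * q ^ 4) (q ^ 4) k"
  define F where "F = qpoch (q ^ 4 / a) (q ^ 4) k"
  define H where "H = qpoch (q ^ 4) (q ^ 4) k"
  have q1: "q * (q ^ 2) ^ j = q ^ (2 * j + 1)" "q ^ 4 * (q ^ 4) ^ j = q ^ (4 * j + 4)" for j
    by (simp_all add: add.commute flip: power_mult power_add)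
  have H: "H \<noteq> 0"
  proof -
    have "1 - q ^ (4 * j + 4) \<noteq> 0" for j using Q[of "4 * j + 3"] by (simp add: numeral_eq_Suc)
    then show ?thesis by (simp add: H_def qpoch_def q1)
  qed
  have num: "(\<Prod>j<k. num_factor q a j) = A * B * a ^ k"
  proof -
    have "a ^ k = (\<Prod>j<k. a)" by simp
    moreover have "num_factor q a j = (1 - a * q * (q ^ 2) ^ j) * (1 - q / a * (q ^ 2) ^ j) * a" for j
      using a by (simp add: num_factor_def mult.assoc q1 field_simps del: power_Suc)
    ultimately show ?thesis by (simp add: A_def B_def qpoch_def prod.distrib)
  qed
  have den: "term_den q a k = C * F * a ^ k * E"
  proof -
    have "a ^ k = (\<Prod>j<k. a)" by simp
    moreover have "den_factor q a j = (1 - a * q ^ 4 * (q ^ 4) ^ j) * (1 - q ^ 4 / a * (q ^ 4) ^ j) * a * (1 + q ^ (2 * j + 2)) ^ 2" for j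
    proof -
      have "(1 - q ^ 4 / a * (q ^ 4) ^ j) * a = a - q ^ 4 * (q ^ 4) ^ j"
        using a by (simp add: field_simps)
      then show ?thesis by (simp only: den_factor_def mult.assoc q1) 
    qed
    ultimately show ?thesis by (simp add: C_def F_def E_def term_den_def qpoch_def prod.distrib)
  qed
  then have nz: "C \<noteq> 0" "F \<noteq> 0" "E \<noteq> 0" using D by auto
  have "qpoch (q ^ 2) (q ^ 4) k = G * H / E"
    using qpoch_qfact_ratio[of q k] nz by (simp add: E_def G_def H_def nonzero_eq_divide_eq)
  then show ?thesis unfolding qterm_def term_num_def den num
    unfolding A_def[symmetric] B_def[symmetric] C_def[symmetric] F_def[symmetric] G_def[symmetric] H_def[symmetric]
    using nz H a by (simp add: mult_ac)
qed

section \<open>Assembling the congruence in the fraction field\<close>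

lemma emb_morphism: "ring_morphism emb"
  by (simp add: ring_morphism_def emb_def One_fract_def)

lemma emb_eq_0_iff: "emb p = 0 \<longleftrightarrow> p = 0"
  by (simp add: emb_def Zero_fract_def eq_fract)

lemma full_den_nonzero:
  assumes "odd n"
  shows "full_den n K L qvar avar \<noteq> 0"
proof
  assume "full_den n K L qvar avar = 0"
  \<comment> \<open>At \<open>q = 2\<close> and \<open>a = 2 ^ n\<close> the parameter is an odd
    power of both bases \<open>2\<close> and \<open>2 ^ n\<close>, so
    \<open>term_den_nonzero\<close> covers both denominators.\<close>
  then have "eval2 2 (2 ^ n) (full_den n K L qvar avar) = 0" by (simp add: eval2_0)
  then have "full_den n K L (2 :: complex) (2 ^ n) = 0"
    by (simp add: morphism_full_den[OF ring_morphism_eval2] eval2_qvar eval2_avar)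
  moreover obtain h where "n = 2 * h + 1" using assms by (rule oddE)
  then have "term_den (2 :: complex) (2 ^ n) K \<noteq> 0"
    using term_den_nonzero[of 2 h K] by simp
  moreover have "norm ((2 :: complex) ^ n) > 1"
    using assms by (simp add: norm_power odd_pos)
  then have "term_den ((2 :: complex) ^ n) (2 ^ n) L \<noteq> 0"
    using term_den_nonzero[of "2 ^ n" 0 L] by simp
  ultimately show False by (simp add: full_den_def)
qed

text \<open>Linear factors of the denominator carry even powers of \<open>q\<close>, those of the
  modulus odd ones. The remaining factors are free of \<open>a\<close>: powers of \<open>q\<close>
  and \<open>1 + q ^ u\<close>, which are coprime to the q-integer.\<close>

lemma coprime_full_den:
  assumes n: "odd n" and N: "odd N"
  shows "coprime (full_den n K L qvar avar)
    (qint qvar N * (\<Prod>j=0..J. (1 - avar * qvar ^ ((2 * j + 1) * n)) * (avar - qvar ^ ((2 * j + 1) * n))))"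
    (is "coprime _ ?P")
proof -
  have N0: "N > 0" using N by (simp add: odd_pos)
  have lin: "coprime p ?P" if "coprime p (qint qvar N)"
    "\<And>s. odd s \<Longrightarrow> coprime p (1 - avar * qvar ^ s)" "\<And>s. odd s \<Longrightarrow> coprime p (avar - qvar ^ s)" for p
    using that n by (auto intro!: prod_coprime_right simp del: mult_Suc_right)
  have X0: "([:0, 1:] :: int poly) \<noteq> 0" by simp
  have X1: "1 + [:0, 1:] ^ u \<noteq> (0 :: int poly)" if "u > 0" for u
  proof
    assume "1 + [:0, 1:] ^ u = (0 :: int poly)"
    then have "poly (1 + [:0, 1:] ^ u) (1 :: int) = 0" by simp
    then show False by simp
  qed
  have q: "coprime qvar ?P"
    using coprime_linear_const[OF X0] coprime_qvar_qint[OF N0]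
    by (intro lin) (simp_all add: qvar_def[symmetric])
  have factor: "coprime ((1 - avar * qvar ^ t) * (avar - qvar ^ t) * (1 + qvar ^ u) ^ 2) ?P"
    if t: "even t" and u: "u > 0" for t u
  proof -
    have c: "coprime (1 + qvar ^ u) ?P"
    proof (rule lin)
      have u': "1 + qvar ^ u = [:1 + [:0, 1:] ^ u:]" by (simp add: qvar_power one_pCons)
      show "coprime (1 + qvar ^ u) (1 - avar * qvar ^ s)" "coprime (1 + qvar ^ u) (avar - qvar ^ s)" for s
        unfolding u' using coprime_linear_const X1[OF u] by blast+
    qed (rule coprime_one_plus_qint[OF N u])
    have neq: "t \<noteq> s" "t + s > 0" if "odd s" for s using that t by (auto intro: odd_pos)
    have qq: "coprime p (qint qvar N)" if "\<And>m. m \<noteq> 0 \<Longrightarrow> coprime [:m:] p" for p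
      using that[OF qint_nonzero[OF N0]] by (simp add: qint_qvar coprime_commute)
    have l1: "coprime (1 - avar * qvar ^ t) ?P"
    proof (rule lin)
      show "coprime (1 - avar * qvar ^ t) (qint qvar N)" by (rule qq) (rule coprime_linear_const)
      fix s :: nat assume s: "odd s"
      show "coprime (1 - avar * qvar ^ t) (1 - avar * qvar ^ s)" by (rule coprime_linear(1)[OF neq(1)[OF s]])
      show "coprime (1 - avar * qvar ^ t) (avar - qvar ^ s)" by (rule coprime_linear(3)[OF neq(2)[OF s]])
    qed
    have l2: "coprime (avar - qvar ^ t) ?P"
    proof (rule lin)
      show "coprime (avar - qvar ^ t) (qint qvar N)" by (rule qq) (rule coprime_linear_const)
      fix s :: nat assume s: "odd s"
      show "coprime (avar - qvar ^ t) (avar - qvar ^ s)" by (rule coprime_linear(2)[OF neq(1)[OF s]])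
      show "coprime (avar - qvar ^ t) (1 - avar * qvar ^ s)"
        using coprime_linear(3)[of s t] neq(2)[OF s] by (simp only: coprime_commute add.commute)
    qed
    show ?thesis using c l1 l2 by (simp only: coprime_mult_left_iff coprime_power_left_iff) simp
  qed
  have "coprime (term_den qvar avar K) ?P"
    unfolding term_den_def den_factor_def by (intro prod_coprime_left factor) simp_all
  moreover have "coprime (term_den (qvar ^ n) avar L) ?P"
    unfolding term_den_def den_factor_def power_mult[symmetric]
    using n by (intro prod_coprime_left factor) (simp_all add: odd_pos)
  ultimately show ?thesis
    using q unfolding full_den_def by (simp only: coprime_mult_left_iff coprime_power_left_iff) simp
qed

text \<open>The linear factors are pairwise coprime and coprime to the q-integer, so divisibility by
  each one separately, tested by evaluation, is enough.\<close>

lemma modulus_dvd: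
  assumes n: "odd n" and N: "N > 0"
    and q: "\<And>z a. z ^ N = 1 \<Longrightarrow> z \<noteq> 1 \<Longrightarrow> norm a > 1 \<Longrightarrow> eval2 z a p = 0"
    and l: "\<And>q j. j \<le> J \<Longrightarrow> norm q > 1 \<Longrightarrow> eval2 q (q ^ ((2 * j + 1) * n)) p = 0"
    and l': "\<And>q j. j \<le> J \<Longrightarrow> norm q > 1 \<Longrightarrow> eval2 q (inverse (q ^ ((2 * j + 1) * n))) p = 0"
  shows "qint qvar N * (\<Prod>j=0..J. (1 - avar * qvar ^ ((2 * j + 1) * n)) * (avar - qvar ^ ((2 * j + 1) * n))) dvd p"
proof -
  define s where "s j = (2 * j + 1) * n" for j
  have n0: "n > 0" using n by (simp add: odd_pos)
  have s: "s i = s j \<longleftrightarrow> i = j" "s i > 0" for i j using n0 by (auto simp: s_def)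
  have "(\<Prod>j=0..J. (1 - avar * qvar ^ s j) * (avar - qvar ^ s j)) dvd p"
  proof (rule prod_dvd_if_coprime)
    fix j assume "j \<in> {0..J}"
    then have "1 - avar * qvar ^ s j dvd p" "avar - qvar ^ s j dvd p"
      using l l' by (auto intro!: one_minus_avar_dvd avar_minus_dvd simp: s_def)
    then show "(1 - avar * qvar ^ s j) * (avar - qvar ^ s j) dvd p"
      using coprime_linear(3)[of "s j" "s j"] s by (intro divides_mult) auto
  next
    fix i j :: nat assume "i \<noteq> j"
    then show "coprime ((1 - avar * qvar ^ s i) * (avar - qvar ^ s i)) ((1 - avar * qvar ^ s j) * (avar - qvar ^ s j))"
      using coprime_linear(1,2)[of "s i" "s j"] coprime_linear(3)[of "s i" "s j"] coprime_linear(3)[of "s j" "s i"] s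
      by (simp add: coprime_commute)
  qed simp
  moreover have "coprime (qint qvar N) (\<Prod>j=0..J. (1 - avar * qvar ^ s j) * (avar - qvar ^ s j))"
    unfolding qint_qvar using coprime_linear_const[OF qint_nonzero[OF N]]
    by (intro prod_coprime_right) simp
  ultimately show ?thesis using qint_qvar_dvd[OF N q] unfolding s_def by (simp add: divides_mult)
qed

theorem theorem3p2:
  fixes n r d :: nat
  assumes "n > 1" and "odd n" and "r \<ge> 1" and "d \<in> {1, 2}"
  shows "qcong
    (\<Sum>k=0..(n ^ r - 1) div d.
        emb qvar ^ (k ^ 2) * qint (emb qvar) (6 * k + 1) *
        (qpoch (emb avar * emb qvar) (emb qvar ^ 2) k
         * qpoch (emb qvar / emb avar) (emb qvar ^ 2) k
         * qpoch (emb qvar ^ 2) (emb qvar ^ 4) k)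
        / (qpoch (emb avar * emb qvar ^ 4) (emb qvar ^ 4) k
         * qpoch (emb qvar ^ 4 / emb avar) (emb qvar ^ 4) k
         * qpoch (emb qvar ^ 4) (emb qvar ^ 4) k))
    ((- emb qvar) powi ((1 - int n) div 2) * qint (emb qvar) n *
     (\<Sum>k=0..(n ^ (r - 1) - 1) div d.
        emb qvar ^ (n * k ^ 2) * qint (emb qvar ^ n) (6 * k + 1) *
        (qpoch (emb avar * emb qvar ^ n) (emb qvar ^ (2 * n)) k
         * qpoch (emb qvar ^ n / emb avar) (emb qvar ^ (2 * n)) k
         * qpoch (emb qvar ^ (2 * n)) (emb qvar ^ (4 * n)) k)
        / (qpoch (emb avar * emb qvar ^ (4 * n)) (emb qvar ^ (4 * n)) k
         * qpoch (emb qvar ^ (4 * n) / emb avar) (emb qvar ^ (4 * n)) k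
         * qpoch (emb qvar ^ (4 * n)) (emb qvar ^ (4 * n)) k)))
    (qint qvar (n ^ r) *
     (\<Prod>j=0..(n ^ (r - 1) - 1) div d.
        (1 - avar * qvar ^ ((2 * j + 1) * n)) * (avar - qvar ^ ((2 * j + 1) * n))))"
    (is "qcong ?A ?B ?P")
proof -
  define K where "K = (n ^ r - 1) div d"
  define L where "L = (n ^ (r - 1) - 1) div d"
  define h where "h = (n - 1) div 2"
  define q where "q = emb qvar"
  define a where "a = emb avar"
  have nh: "n = 2 * h + 1" using assms(2) by (auto simp: h_def elim!: oddE)
  have a0: "a \<noteq> 0" by (simp add: a_def emb_eq_0_iff avar_def)
  have q0: "q \<noteq> 0" by (simp add: q_def emb_eq_0_iff qvar_def)
  have q1: "1 - q ^ Suc j \<noteq> 0" for j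
  proof -
    \<comment> \<open>Nonvanishing is tested at \<open>q = 2\<close>; the value 0 for
      \<open>a\<close> is arbitrary, as \<open>a\<close> does not occur.\<close>
    have "eval2 2 0 (1 - qvar ^ Suc j) \<noteq> 0"
      using power_inj_norm[of 2 "Suc j" 0]
      by (simp add: morphism_simps[OF ring_morphism_eval2] eval2_qvar)
    then have "1 - qvar ^ Suc j \<noteq> 0" using eval2_0 by metis
    then have "emb (1 - qvar ^ Suc j) \<noteq> 0" by (simp only: emb_eq_0_iff simp_thms)
    then show ?thesis by (simp only: morphism_simps[OF emb_morphism] q_def simp_thms)
  qed
  have D: "emb (full_den n K L qvar avar) = full_den n K L q a" "full_den n K L q a \<noteq> 0"
    using full_den_nonzero[OF assms(2), of K L]
    by (simp_all add: morphism_full_den[OF emb_morphism] q_def a_def flip: emb_eq_0_iff)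
  then have tK: "term_den q a K \<noteq> 0" and tL: "term_den (q ^ n) a L \<noteq> 0"
    by (auto simp: full_den_def)
  have mono: "term_den x a k \<noteq> 0" if "term_den x a M \<noteq> 0" "k \<le> M" for x k M
    using that by (auto simp: term_den_def)
  have A: "?A = sum_num q a K / term_den q a K"
    unfolding sum_num_div[OF tK, symmetric] K_def[symmetric] q_def[symmetric] a_def[symmetric]
    by (intro sum.cong refl, subst qterm_qpoch[OF a0 mono[OF tK] q1]) (auto simp: qterm_def)
  have B: "?B = (- 1) ^ h / q ^ h * qint q n * (sum_num (q ^ n) a L / term_den (q ^ n) a L)"
  proof -
    have "1 - (q ^ n) ^ Suc j \<noteq> 0" for j
    proof -
      have "n * Suc j = Suc (n * Suc j - 1)" using nh by simp
      then show ?thesis using q1[of "n * Suc j - 1"] by (metis power_mult)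
    qed
    note qt = qterm_qpoch[OF a0 mono[OF tL] this]
    have pw: "q ^ (n * m) = (q ^ n) ^ m" "q ^ (m * n) = (q ^ n) ^ m" for m
      by (simp_all flip: power_mult add: mult.commute)
    \<comment> \<open>The integer division is exact, since \<open>1 - n = - 2 * h\<close>.\<close>
    have "(1 - int n) div 2 = - int h" using nh by simp
    then have "(- q) powi ((1 - int n) div 2) = inverse ((- 1) ^ h * q ^ h)"
      by (simp add: power_int_minus flip: power_mult_distrib)
    also have "\<dots> = (- 1) ^ h / q ^ h"
      using q0 by (simp add: field_simps flip: power_mult_distrib)
    finally have P: "(- q) powi ((1 - int n) div 2) = (- 1) ^ h / q ^ h" .
    show ?thesis
      unfolding sum_num_div[OF tL, symmetric] L_def[symmetric] q_def[symmetric] a_def[symmetric] P pw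
      by (intro arg_cong2[where f = "(*)"] sum.cong refl, subst qt) (auto simp: qterm_def)
  qed
  have "?A - ?B = full_num n K L q a / full_den n K L q a"
    unfolding A B full_num_def full_den_def h_def[symmetric] using tK tL q0 by (simp add: field_simps)
  also have "\<dots> = Fract (full_num n K L qvar avar) (full_den n K L qvar avar)"
  proof -
    have "full_num n K L q a = emb (full_num n K L qvar avar)"
      by (simp add: morphism_full_num[OF emb_morphism] q_def a_def)
    then show ?thesis unfolding D(1)[symmetric] by (simp add: emb_def)
  qed
  finally have AB: "?A - ?B = Fract (full_num n K L qvar avar) (full_den n K L qvar avar)" .
  have ev: "eval2 x y (full_num n K L qvar avar) = full_num n K L x y" for x y
    by (simp add: morphism_full_num[OF ring_morphism_eval2] eval2_qvar eval2_avar)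
  \<comment> \<open>The left sum must reach the index beyond which all its terms vanish at
    \<open>a = q ^ ((2 * j + 1) * n)\<close>; the range of \<open>j\<close> in the modulus ensures
    this for both values of \<open>d\<close>.\<close>
  have hK: "((2 * j + 1) * n - 1) div 2 \<le> K" if "j \<le> L" for j
  proof -
    have nr: "n ^ r = n ^ (r - 1) * n" using assms(3) by (cases r) auto
    have n1: "n ^ (r - 1) \<ge> 1" using nh by simp
    show ?thesis
    proof (cases "d = 1")
      case True
      then have "j + 1 \<le> n ^ (r - 1)" using that n1 by (simp add: L_def)
      then have "(j + 1) * n \<le> n ^ r" unfolding nr by (rule mult_right_mono) simp
      then have "j * n + n \<le> n ^ r" by simp
      moreover have "h < n" using nh by simp
      ultimately have "j * n + h \<le> n ^ r - 1" by linarith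
      moreover have "((2 * j + 1) * n - 1) div 2 = j * n + h" using nh by (simp add: algebra_simps)
      ultimately show ?thesis using True by (simp add: K_def)
    next
      case False
      then have d: "d = 2" using assms(4) by simp
      have "2 * j + 1 \<le> n ^ (r - 1)" using that n1 by (simp add: L_def d)
      then have "(2 * j + 1) * n \<le> n ^ r" unfolding nr by (rule mult_right_mono) simp
      then show ?thesis unfolding K_def d by (intro div_le_mono diff_le_mono)
    qed
  qed
  have at_power: "full_num n K L x (x ^ ((2 * j + 1) * n)) = 0" if "j \<le> L" "norm x > 1" for x :: complex and j
    using that hK by (intro full_num_at_power assms(2)) auto
  have "?P dvd full_num n K L qvar avar"
    unfolding L_def[symmetric]
  proof (rule modulus_dvd[OF assms(2)])
    show "n ^ r > 0" using nh by simp
    show "eval2 z y (full_num n K L qvar avar) = 0" if "z ^ (n ^ r) = 1" "z \<noteq> 1" "norm y > 1" for z y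
      unfolding ev unfolding K_def L_def using that assms by (intro full_num_root_of_unity)
    show "eval2 x (x ^ ((2 * j + 1) * n)) (full_num n K L qvar avar) = 0" if "j \<le> L" "norm x > 1" for x j
      unfolding ev using that by (rule at_power)
    show "eval2 x (inverse (x ^ ((2 * j + 1) * n))) (full_num n K L qvar avar) = 0" if "j \<le> L" "norm x > 1" for x j
      unfolding ev using that by (intro full_num_inverse at_power) auto
  qed
  moreover have "coprime (full_den n K L qvar avar) ?P"
    using assms(2) by (intro coprime_full_den) auto
  ultimately show ?thesis
    unfolding qcong_def using AB full_den_nonzero[OF assms(2)] by blast
qed

end
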